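(* Let $T$ be a left Noetherian ring which is integral over its center. Then either $T$ has a maximal subring or $|T|\leq 2^{\aleph_0}$.
   Context: All rings are associative with identity $1\neq0$; subrings contain the identity. A maximal subring of $T$ is a proper subring with no subring strictly between it and $T$. $T$ is integral over its center $C(T)$ if every element of $T$ is a root of a monic polynomial with coefficients in $C(T)$. *)

theory Defs
  imports Main
begin

definition is_subring :: "'a::ring_1 set \<Rightarrow> bool" where
  "is_subring S \<longleftrightarrow> 1 \<in> S \<and> (\<forall>x\<in>S. \<forall>y\<in>S. x - y \<in> S \<and> x * y \<in> S)"

definition maximal_subring :: "'a::ring_1 set \<Rightarrow> bool" where
  "maximal_subring S \<longleftrightarrow> is_subring S \<and> S \<noteq> UNIV \<and>
     (\<forall>S'. is_subring S' \<and> S \<subseteq> S' \<longrightarrow> S' = S \<or> S' = UNIV)"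

definition has_maximal_subring :: "'a::ring_1 itself \<Rightarrow> bool" where
  "has_maximal_subring _ \<longleftrightarrow> (\<exists>S::'a set. maximal_subring S)"

definition left_ideal :: "'a::ring_1 set \<Rightarrow> bool" where
  "left_ideal I \<longleftrightarrow> 0 \<in> I \<and> (\<forall>x\<in>I. \<forall>y\<in>I. x - y \<in> I) \<and> (\<forall>r. \<forall>x\<in>I. r * x \<in> I)"

definition left_noetherian :: "'a::ring_1 itself \<Rightarrow> bool" where
  "left_noetherian _ \<longleftrightarrow> (\<forall>I :: nat \<Rightarrow> 'a set. (\<forall>n. left_ideal (I n)) \<and> (\<forall>n. I n \<subseteq> I (Suc n))
       \<longrightarrow> (\<exists>N. \<forall>m\<ge>N. I m = I N))"

definition center :: "'a::ring_1 set" where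
  "center = {c. \<forall>x. c * x = x * c}"

definition integral_over_center :: "'a::ring_1 itself \<Rightarrow> bool" where
  "integral_over_center _ \<longleftrightarrow> (\<forall>x::'a. \<exists>n (c :: nat \<Rightarrow> 'a). (\<forall>i<n. c i \<in> center) \<and>
       x ^ n + (\<Sum>i<n. c i * x ^ i) = 0)"

end

theory Submission
  imports Defs "HOL-Computational_Algebra.Polynomial" "HOL-Library.Countable_Set"
begin

text \<open>Suppose that \<open>T\<close> has no maximal subring and more than continuum many elements. By noetherian
  induction we may pass to a quotient all of whose proper quotients have at most continuum many
  elements. This quotient is prime, since a product of two nonzero ideals being zero would exhibit it
  as an extension of small modules, and its center is a field, since for a central nonzero nonunit
  \<open>c\<close> the ring would be determined by \<open>c\<close>-adic expansions over the small quotient by \<open>c\<close>. Being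
  algebraic over its center, it contains a nontrivial idempotent unless it is a division ring, and
  then a ring of triangular Peirce type is a proper subring over which it is finitely generated. If
  the division ring is not commutative, it is finitely generated over the centralizer of a noncentral
  element. A field with a transcendental element is generated by the inverse of one element over a
  suitable valuation ring. In each case Zorn's lemma yields a maximal subring; what
  remains are fields algebraic over their prime subring, which are countable.\<close>

section \<open>Subrings and maximal subrings\<close>

text \<open>Cardinality enters through the reduction alone. An element is coded by the countable
  sequence of its \<open>c\<close>-adic digits, each a set of naturals, and the continuum is the
  right bound because a sequence of such sets is again coded by one set of naturals; countability
  would not survive this step. Passing to a quotient costs nothing, since maximal subrings pull back
  along surjections. Once the center is a field, the arguments are algebraic: every element
  satisfies a relation whose lowest nonzero coefficient is a central unit. Largeness returns only at
  the very end, where it contradicts countability. What makes Zorn's lemma stop at a proper subring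
  is finite generation over a proper subring, and each case is arranged to provide it.\<close>

lemma subring_closed:
  assumes "is_subring S"
  shows subring_one: "1 \<in> S" and subring_zero: "0 \<in> S"
    and subring_diff: "\<And>x y. x \<in> S \<Longrightarrow> y \<in> S \<Longrightarrow> x - y \<in> S"
    and subring_mult: "\<And>x y. x \<in> S \<Longrightarrow> y \<in> S \<Longrightarrow> x * y \<in> S"
    and subring_uminus: "\<And>x. x \<in> S \<Longrightarrow> - x \<in> S"
    and subring_add: "\<And>x y. x \<in> S \<Longrightarrow> y \<in> S \<Longrightarrow> x + y \<in> S"
proof -
  show one: "1 \<in> S" using assms by (simp add: is_subring_def)
  show diff: "\<And>x y. x \<in> S \<Longrightarrow> y \<in> S \<Longrightarrow> x - y \<in> S"
    using assms by (simp add: is_subring_def)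
  show "\<And>x y. x \<in> S \<Longrightarrow> y \<in> S \<Longrightarrow> x * y \<in> S" using assms by (simp add: is_subring_def)
  show zero: "0 \<in> S" using diff[OF one one] by simp
  show um: "- x \<in> S" if "x \<in> S" for x using diff[OF zero that] by simp
  show "x + y \<in> S" if "x \<in> S" "y \<in> S" for x y using diff[OF that(1) um[OF that(2)]] by simp
qed

lemma subring_power: "is_subring S \<Longrightarrow> x \<in> S \<Longrightarrow> x ^ n \<in> S"
  by (induction n) (auto simp: subring_one subring_mult)

lemma subring_sum: "is_subring S \<Longrightarrow> (\<And>i. i \<in> A \<Longrightarrow> g i \<in> S) \<Longrightarrow> sum g A \<in> S"
  by (induction A rule: infinite_finite_induct) (auto simp: subring_zero subring_add)

lemma subring_Union_chain:
  assumes "\<C> \<noteq> {}" "subset.chain \<A> \<C>" "\<And>S. S \<in> \<C> \<Longrightarrow> is_subring S"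
  shows "is_subring (\<Union>\<C>)"
  unfolding is_subring_def
proof (intro conjI ballI)
  show "1 \<in> \<Union>\<C>" using assms(1,3) subring_one by blast
  fix x y assume "x \<in> \<Union>\<C>" "y \<in> \<Union>\<C>"
  then obtain S S' where S: "S \<in> \<C>" "S' \<in> \<C>" "x \<in> S" "y \<in> S'" by blast
  then have "S \<subseteq> S' \<or> S' \<subseteq> S" using assms(2) by (auto simp: subset_chain_def)
  then obtain S where "S \<in> \<C>" "x \<in> S" "y \<in> S" using S by blast
  then show "x - y \<in> \<Union>\<C>" "x * y \<in> \<Union>\<C>"
    using assms(3) subring_diff subring_mult by blast+
qed

lemma finite_subset_Union_chain:
  assumes "finite X" "X \<subseteq> \<Union>\<C>" "\<C> \<noteq> {}" "subset.chain \<A> \<C>"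
  obtains S where "S \<in> \<C>" "X \<subseteq> S"
  using assms(1,2)
proof (induction X arbitrary: thesis rule: finite_induct)
  case empty
  then show ?case using assms(3) by blast
next
  case (insert x X)
  then obtain S where S: "S \<in> \<C>" "X \<subseteq> S" by blast
  obtain S' where S': "S' \<in> \<C>" "x \<in> S'" using insert.prems by auto
  have "S \<subseteq> S' \<or> S' \<subseteq> S" using S S' assms(4) by (auto simp: subset_chain_def)
  then show ?case using S S' insert.prems(1) by blast
qed

text \<open>Zorn's lemma is applied to the subrings over \<open>S\<close> that miss some element of
  \<open>X\<close>. Finiteness of \<open>X\<close> preserves this under unions of chains, and a
  subring strictly above a maximal such one contains \<open>X\<close>, hence is everything.\<close>

lemma finitely_generated_imp_maximal_subring:
  fixes S :: "'a::ring_1 set"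
  assumes S: "is_subring S" "S \<noteq> UNIV" and X: "finite X"
    and gen: "\<And>S'. is_subring S' \<Longrightarrow> S \<subseteq> S' \<Longrightarrow> X \<subseteq> S' \<Longrightarrow> S' = UNIV"
  shows "has_maximal_subring TYPE('a)"
proof -
  let ?A = "{S'. is_subring S' \<and> S \<subseteq> S' \<and> \<not> X \<subseteq> S'}"
  have "\<exists>M\<in>?A. \<forall>S'\<in>?A. M \<subseteq> S' \<longrightarrow> S' = M"
  proof (rule subset_Zorn_nonempty)
    have "S \<in> ?A" using S gen by blast
    then show "?A \<noteq> {}" by blast
    fix \<C> assume C: "\<C> \<noteq> {}" "subset.chain ?A \<C>"
    then have sub: "\<C> \<subseteq> ?A" by (simp add: subset_chain_def)
    have "is_subring (\<Union>\<C>)" using C sub by (intro subring_Union_chain) auto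
    moreover have "\<not> X \<subseteq> \<Union>\<C>"
      using finite_subset_Union_chain[OF X _ C] sub by blast
    ultimately show "\<Union>\<C> \<in> ?A" using C(1) sub by blast
  qed
  then obtain M where M: "M \<in> ?A" "\<forall>S'\<in>?A. M \<subseteq> S' \<longrightarrow> S' = M" by (rule bexE)
  have "maximal_subring M"
    unfolding maximal_subring_def
  proof (intro conjI allI impI)
    show "is_subring M" "M \<noteq> UNIV" using M(1) by auto
    fix S' assume "is_subring S' \<and> M \<subseteq> S'"
    then show "S' = M \<or> S' = UNIV" using M gen[of S'] by blast
  qed
  then show ?thesis by (auto simp: has_maximal_subring_def)
qed

section \<open>The ascending chain condition on left ideals\<close>

lemma left_noetherian_maximal:
  fixes \<S> :: "'a::ring_1 set set"
  assumes noeth: "left_noetherian TYPE('a)" and "\<S> \<noteq> {}" "\<And>I. I \<in> \<S> \<Longrightarrow> left_ideal I"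
  obtains (maximalI) M where "M \<in> \<S>" "\<And>I. I \<in> \<S> \<Longrightarrow> M \<subseteq> I \<Longrightarrow> I = M"
proof (rule ccontr)
  assume neg: "\<not> thesis"
  have step: "\<exists>I'\<in>\<S>. I \<subset> I'" if "I \<in> \<S>" for I
    using neg maximalI \<open>I \<in> \<S>\<close> by blast
  obtain I0 where I0: "I0 \<in> \<S>" using assms(2) by blast
  have "\<exists>J. \<forall>n. J n \<in> \<S> \<and> J n \<subset> J (Suc n)"
    by (rule dependent_nat_choice) (use I0 step in blast)+
  then obtain J where J: "\<And>n. J n \<in> \<S>" "\<And>n. J n \<subset> J (Suc n)" by blast
  then have "(\<forall>n. left_ideal (J n)) \<and> (\<forall>n. J n \<subseteq> J (Suc n))" using assms(3) by blast
  then obtain N where N: "\<And>m. m \<ge> N \<Longrightarrow> J m = J N"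
    using noeth unfolding left_noetherian_def by blast
  show False using J(2)[of N] N[of "Suc N"] by simp
qed

text \<open>Meaningful for finite \<open>G\<close> only: over an infinite set the sum is 0 by
  convention.\<close>

definition left_span :: "'a::ring_1 set \<Rightarrow> 'a set" where
  "left_span G = {\<Sum>g\<in>G. r g * g |r. True}"

lemma left_ideal_left_span: "left_ideal (left_span G)"
  unfolding left_ideal_def
proof (intro conjI ballI allI)
  show "0 \<in> left_span G" unfolding left_span_def by (auto intro!: exI[of _ "\<lambda>_. 0"])
  fix x assume "x \<in> left_span G"
  then obtain r where r: "x = (\<Sum>g\<in>G. r g * g)" unfolding left_span_def by blast
  show "s * x \<in> left_span G" for s
    unfolding left_span_def r
    by (auto intro!: exI[of _ "\<lambda>g. s * r g"] simp: sum_distrib_left mult.assoc)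
  fix y assume "y \<in> left_span G"
  then obtain r' where r': "y = (\<Sum>g\<in>G. r' g * g)" unfolding left_span_def by blast
  show "x - y \<in> left_span G"
    unfolding left_span_def r r'
    by (auto intro!: exI[of _ "\<lambda>g. r g - r' g"] simp: sum_subtractf left_diff_distrib)
qed

lemma left_span_superset: "finite G \<Longrightarrow> G \<subseteq> left_span G"
proof
  fix h assume "finite G" "h \<in> G"
  then have "(\<Sum>g\<in>G. (if g = h then 1 else 0) * g) = h"
    by (simp add: if_distrib[of "\<lambda>t. t * _"] sum.delta cong: if_cong)
  then show "h \<in> left_span G" unfolding left_span_def by (auto intro!: exI[of _ "\<lambda>g. if g = h then 1 else 0"])
qed

lemma left_span_minimal:
  assumes "left_ideal L" "G \<subseteq> L" shows "left_span G \<subseteq> L"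
proof -
  have add: "x + y \<in> L" if "x \<in> L" "y \<in> L" for x y
    using assms(1) that unfolding left_ideal_def by (metis diff_0 diff_minus_eq_add)
  have "(\<Sum>g\<in>H. r g * g) \<in> L" if "H \<subseteq> L" for H r
    using that assms(1) by (induction H rule: infinite_finite_induct) (auto intro!: add simp: left_ideal_def)
  then show ?thesis using assms(2) unfolding left_span_def by blast
qed

text \<open>A maximal member among the left ideals generated by finite subsets of \<open>G\<close>
  absorbs every element of \<open>G\<close>. The generators lie in \<open>G\<close> itself, which
  need not be a left ideal; this is used for a Peirce component.\<close>

lemma left_noetherian_finite_subset:
  fixes G :: "'a::ring_1 set"
  assumes "left_noetherian TYPE('a)"
  obtains H where "finite H" "H \<subseteq> G" "G \<subseteq> left_span H"
proof -
  let ?S = "left_span ` {H. finite H \<and> H \<subseteq> G}"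
  have "?S \<noteq> {}" by blast
  then obtain M where M: "M \<in> ?S" "\<And>I. I \<in> ?S \<Longrightarrow> M \<subseteq> I \<Longrightarrow> I = M"
    by (rule left_noetherian_maximal[OF assms]) (use left_ideal_left_span in auto)
  then obtain H where H: "M = left_span H" "finite H" "H \<subseteq> G" by blast
  have "g \<in> left_span H" if "g \<in> G" for g
  proof -
    have "left_span H \<subseteq> left_span (insert g H)"
      using left_span_superset[of "insert g H"] H(2) by (intro left_span_minimal left_ideal_left_span) auto
    then have "left_span (insert g H) = left_span H"
      using M(2)[of "left_span (insert g H)"] H that by blast
    then show ?thesis using left_span_superset[of "insert g H"] H(2) by blast
  qed
  then show ?thesis using that H by blast
qed

section \<open>Quotients of cardinality at most the continuum\<close>

text \<open>\<^term>\<open>small_quotient I\<close> says that the additive quotient by \<^term>\<open>I\<close> has at most continuum many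
  elements; the code of a coset may depend on the representative, which avoids choosing one.\<close>

definition small_quotient :: "'a::ring_1 set \<Rightarrow> bool" where
  "small_quotient I \<longleftrightarrow> (\<exists>f :: 'a \<Rightarrow> nat set. \<forall>x y. f x = f y \<longrightarrow> x - y \<in> I)"

lemma small_quotient_zero_iff: "small_quotient {0 :: 'a::ring_1} \<longleftrightarrow> (\<exists>f :: 'a \<Rightarrow> nat set. inj f)"
  by (simp add: small_quotient_def inj_def)

text \<open>The continuum raised to a countable power is the continuum: a sequence of sets becomes
  its disjoint union, flattened by the pairing function.\<close>

lemma inj_seq_of_nat_sets: "\<exists>e :: (nat \<Rightarrow> nat set) \<Rightarrow> nat set. inj e"
proof (intro exI injI)
  fix F G :: "nat \<Rightarrow> nat set"
  assume "prod_encode ` (SIGMA n:UNIV. F n) = prod_encode ` (SIGMA n:UNIV. G n)"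
  then have "(SIGMA n:UNIV. F n) = (SIGMA n:UNIV. G n)"
    by (simp add: inj_image_eq_iff inj_prod_encode)
  then show "F = G" by (auto simp: fun_eq_iff set_eq_iff)
qed

lemma small_quotientI_seq:
  fixes F :: "'a::ring_1 \<Rightarrow> nat \<Rightarrow> nat set"
  assumes "\<And>x y. (\<And>n. F x n = F y n) \<Longrightarrow> x - y \<in> I"
  shows "small_quotient I"
proof -
  obtain e :: "(nat \<Rightarrow> nat set) \<Rightarrow> nat set" where "inj e" using inj_seq_of_nat_sets by blast
  then show ?thesis unfolding small_quotient_def
    by (intro exI[of _ "\<lambda>x. e (F x)"]) (auto simp: inj_eq intro: assms)
qed

text \<open>The map \<open>r\<close> picks one representative per code rather than per coset, so
  equal codes have equal remainders and these cancel in differences.\<close>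

lemma small_quotient_representative:
  fixes I :: "'a::ring_1 set"
  assumes "small_quotient I"
  obtains f :: "'a \<Rightarrow> nat set" and r where "\<And>x y. f x = f y \<Longrightarrow> x - y \<in> I"
    "\<And>x y. f x = f y \<Longrightarrow> r x = r y" "\<And>x. x - r x \<in> I"
proof -
  obtain f :: "'a \<Rightarrow> nat set" where f: "\<And>x y. f x = f y \<Longrightarrow> x - y \<in> I"
    using assms unfolding small_quotient_def by blast
  define r where "r x = (SOME z. f z = f x)" for x
  have "f (r x) = f x" for x unfolding r_def by (rule someI) simp
  then show ?thesis using that[of f r] f unfolding r_def by metis
qed

definition two_sided_ideal :: "'a::ring_1 set \<Rightarrow> bool" where
  "two_sided_ideal I \<longleftrightarrow> left_ideal I \<and> (\<forall>r. \<forall>x\<in>I. x * r \<in> I)"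

text \<open>\<^term>\<open>B\<close> is a finitely generated left module over the small ring of cosets of \<^term>\<open>A\<close>.\<close>

lemma small_quotient_product:
  fixes A B :: "'a::ring_1 set"
  assumes noeth: "left_noetherian TYPE('a)"
    and small: "small_quotient A" "small_quotient B"
    and B: "left_ideal B" and AB: "\<And>a b. a \<in> A \<Longrightarrow> b \<in> B \<Longrightarrow> a * b = 0"
  shows "small_quotient {0 :: 'a}"
proof -
  obtain H where H: "finite H" "H \<subseteq> B" "B \<subseteq> left_span H"
    using left_noetherian_finite_subset[OF noeth] by blast
  obtain h n where h: "H = h ` {i::nat. i < n}" "inj_on h {i. i < n}"
    using finite_imp_nat_seg_image_inj_on[OF H(1)] by blast
  obtain f :: "'a \<Rightarrow> nat set" and r where f: "\<And>x y. f x = f y \<Longrightarrow> r x = r y" "\<And>x. x - r x \<in> B"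
    using small_quotient_representative[OF small(2)] by metis
  obtain g :: "'a \<Rightarrow> nat set" where g: "\<And>x y. g x = g y \<Longrightarrow> x - y \<in> A"
    using small(1) unfolding small_quotient_def by blast
  have "\<exists>t. x - r x = (\<Sum>i<n. t i * h i)" for x
  proof -
    have "x - r x \<in> left_span H" using f(2) H(3) by blast
    then obtain s where "x - r x = (\<Sum>b\<in>H. s b * b)" unfolding left_span_def by blast
    also have "\<dots> = (\<Sum>i<n. s (h i) * h i)"
      using h by (simp add: sum.reindex lessThan_def)
    finally show ?thesis by (intro exI[of _ "\<lambda>i. s (h i)"])
  qed
  then obtain t where t: "\<And>x. x - r x = (\<Sum>i<n. t x i * h i)" by metis
  show ?thesis
  \<comment> \<open>Entry 0 is the code of \<open>x\<close> modulo \<open>B\<close>; the later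
    entries code the coefficients of \<open>x - r x\<close> modulo \<open>A\<close>, which suffices
    because \<open>A\<close> annihilates the generators in \<open>B\<close>. Entries beyond the
    \<open>n\<close> coefficients are arbitrary and harmless.\<close>
  proof (rule small_quotientI_seq[where F = "\<lambda>x. case_nat (f x) (\<lambda>i. g (t x i))"])
    fix x y assume eq: "\<And>n. case_nat (f x) (\<lambda>i. g (t x i)) n = case_nat (f y) (\<lambda>i. g (t y i)) n"
    have rxy: "r x = r y" using f(1)[of x y] eq[of 0] by simp
    have "t x i - t y i \<in> A" for i using g[of "t x i" "t y i"] eq[of "Suc i"] by simp
    moreover have "h i \<in> B" if "i < n" for i using that H(2) h(1) by blast
    ultimately have "(t x i - t y i) * h i = 0" if "i < n" for i using that AB by blast
    then have "(\<Sum>i<n. t x i * h i) = (\<Sum>i<n. t y i * h i)"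
      by (intro sum.cong) (auto simp: left_diff_distrib)
    then have "x - r x = y - r x" using t[of x] t[of y] rxy by simp
    then show "x - y \<in> {0}" by simp
  qed
qed

text \<open>The \<^term>\<open>c\<close>-adic expansion of an element determines it up to the intersection of the
  ideals generated by the powers of \<^term>\<open>c\<close>.\<close>

lemma small_quotient_adic:
  fixes c :: "'a::ring_1"
  assumes small: "small_quotient (range ((*) c))"
    and inter: "\<And>z :: nat \<Rightarrow> 'a. (\<And>n. z n = c * z (Suc n)) \<Longrightarrow> z 0 = 0"
  shows "small_quotient {0 :: 'a}"
proof -
  obtain f :: "'a \<Rightarrow> nat set" and r where f: "\<And>x y. f x = f y \<Longrightarrow> r x = r y"
    "\<And>x. x - r x \<in> range ((*) c)"
    using small_quotient_representative[OF small] by metis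
  then have "\<exists>y. x - r x = c * y" for x by blast
  then obtain q where q: "\<And>x. x - r x = c * q x" by metis
  \<comment> \<open>\<open>X x n\<close> is what remains of \<open>x\<close> after \<open>n\<close>
    divisions by \<open>c\<close>, so its code plays the role of the digit of index
    \<open>n\<close>.\<close>
  define X where "X x n = (q ^^ n) x" for x n
  show ?thesis
  proof (rule small_quotientI_seq[where F = "\<lambda>x n. f (X x n)"])
    fix x y assume eq: "\<And>n. f (X x n) = f (X y n)"
    have "X x n - X y n = c * (X x (Suc n) - X y (Suc n))" for n
    proof -
      have "X x n - X y n = (X x n - r (X x n)) - (X y n - r (X y n))"
        using f(1)[OF eq[of n]] by simp
      then show ?thesis by (simp add: q X_def right_diff_distrib)
    qed
    then have "X x 0 - X y 0 = 0" using inter[of "\<lambda>n. X x n - X y n"] by blast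
    then show "x - y \<in> {0}" by (simp add: X_def)
  qed
qed

section \<open>Zero divisors produce a maximal subring\<close>

text \<open>The Peirce component \<^term>\<open>(1 - e) * r * e\<close> is a finitely generated module over the
  subring where it vanishes.\<close>

lemma idempotent_imp_maximal_subring:
  fixes e :: "'a::ring_1"
  assumes noeth: "left_noetherian TYPE('a)" and e: "e * e = e" and r: "(1 - e) * r * e \<noteq> 0"
  shows "has_maximal_subring TYPE('a)"
proof -
  define f where "f = 1 - e"
  have f: "f * f = f" "f * e = 0" "f + e = 1"
    using e by (simp_all add: f_def algebra_simps)
  define S where "S = {x. f * x * e = 0}"
  define G where "G = {f * x * e |x. True}"
  obtain H where H: "finite H" "H \<subseteq> G" "G \<subseteq> left_span H"
    using left_noetherian_finite_subset[OF noeth] by blast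
  have S: "is_subring S"
    unfolding is_subring_def
  proof (intro conjI ballI)
    show "1 \<in> S" using f by (simp add: S_def)
    fix x y assume xy: "x \<in> S" "y \<in> S"
    then show "x - y \<in> S" by (simp add: S_def algebra_simps)
    have "f * (x * y) * e = f * x * (f + e) * y * e" by (simp add: f(3) mult.assoc)
    also have "\<dots> = f * x * (f * y * e) + (f * x * e) * y * e" by (simp add: algebra_simps)
    also have "\<dots> = 0" using xy by (simp add: S_def)
    finally show "x * y \<in> S" by (simp add: S_def)
  qed
  show ?thesis
  proof (rule finitely_generated_imp_maximal_subring[OF S _ H(1)])
    show "S \<noteq> UNIV" using r by (auto simp: S_def f_def)
    fix S' assume S': "is_subring S'" "S \<subseteq> S'" "H \<subseteq> S'"
    have G: "g \<in> S'" if g: "g \<in> G" for g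
    proof -
      have fG: "f * h = h" if "h \<in> G" for h
        using that by (auto simp: G_def f(1) mult.assoc[symmetric])
      obtain t where t: "g = (\<Sum>h\<in>H. t h * h)" using H(3) g unfolding left_span_def by blast
      then have "g = f * (\<Sum>h\<in>H. t h * h)" using fG[OF g] by simp
      \<comment> \<open>Left multiplication by \<open>f\<close> fixes \<open>G\<close>, so each
        coefficient may be compressed to the corner element \<open>f * t h * f\<close>, which
        belongs to \<open>S\<close> because \<open>f * e = 0\<close>.\<close>
      also have "\<dots> = (\<Sum>h\<in>H. (f * t h * f) * h)"
        unfolding sum_distrib_left
        by (rule sum.cong) (use H(2) fG in \<open>auto simp: mult.assoc\<close>)
      also have "\<dots> \<in> S'"
      proof (rule subring_sum[OF S'(1)])
        fix h assume "h \<in> H"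
        then have "h \<in> S'" using S'(3) by blast
        moreover have "f * t h * f \<in> S" by (simp add: S_def mult.assoc f(2))
        ultimately show "f * t h * f * h \<in> S'" using S'(2) by (blast intro: subring_mult[OF S'(1)])
      qed
      finally show ?thesis .
    qed
    have "x \<in> S'" for x
    proof -
      have "f * (x - f * x * e) * e = f * x * e - (f * f) * x * (e * e)"
        by (simp add: right_diff_distrib left_diff_distrib mult.assoc)
      then have "x - f * x * e \<in> S" by (simp add: S_def e f(1))
      moreover have "f * x * e \<in> S'" using G by (auto simp: G_def)
      ultimately have "(x - f * x * e) + f * x * e \<in> S'"
        using S'(1,2) by (intro subring_add) auto
      then show ?thesis by simp
    qed
    then show "S' = UNIV" by blast
  qed
qed

text \<open>Take a nonzero \<open>b\<close> in the right ideal with maximal left annihilator. If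
  \<open>b * x\<close> is nilpotent and nonzero, its last nonzero power is a right multiple of
  \<open>b\<close>, hence has the same annihilator; \<open>b * x\<close> kills that power and
  therefore kills \<open>b\<close>. Thus \<open>b * x * b = 0\<close> for all \<open>x\<close>,
  against primeness.\<close>

lemma nonzero_right_ideal_not_nil:
  fixes a :: "'a::ring_1"
  assumes noeth: "left_noetherian TYPE('a)"
    and prime: "\<And>a b :: 'a. (\<And>r. a * r * b = 0) \<Longrightarrow> a = 0 \<or> b = 0"
    and "a \<noteq> 0"
  shows "\<exists>x. \<forall>k. (a * x) ^ k \<noteq> 0"
proof (rule ccontr)
  assume "\<not> ?thesis"
  then have nil: "\<exists>k. (a * x) ^ k = 0" for x by blast
  define ann where "ann b = {r :: 'a. r * b = 0}" for b
  define \<S> where "\<S> = {ann (a * x) |x. a * x \<noteq> 0}"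
  have "ann (a * 1) \<in> \<S>" using \<open>a \<noteq> 0\<close> unfolding \<S>_def by (intro CollectI exI[of _ 1]) simp
  moreover have "left_ideal I" if "I \<in> \<S>" for I
    using that by (auto simp: \<S>_def left_ideal_def ann_def left_diff_distrib mult.assoc)
  ultimately obtain M where M: "M \<in> \<S>" "\<And>I. I \<in> \<S> \<Longrightarrow> M \<subseteq> I \<Longrightarrow> I = M"
    using left_noetherian_maximal[OF noeth, of \<S>] by (metis empty_iff)
  then obtain x0 where x0: "M = ann (a * x0)" "a * x0 \<noteq> 0" unfolding \<S>_def by blast
  define b where "b = a * x0"
  have "b * x * b = 0" for x
  proof (cases "b * x = 0")
    case False
    have ex: "\<exists>k. (b * x) ^ k = 0" using nil[of "x0 * x"] by (simp add: b_def mult.assoc)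
    define k where "k = (LEAST k. (b * x) ^ k = 0)"
    have k: "(b * x) ^ k = 0" unfolding k_def using LeastI_ex[OF ex] .
    have "k \<noteq> 0" "k \<noteq> Suc 0"
      using k False by (metis power_0 zero_neq_one, metis power_Suc0_right)
    then obtain m where m: "k = Suc (Suc m)" by (metis not0_implies_Suc)
    \<comment> \<open>The last nonzero power; its exponent is positive, so it starts with the factor
      \<open>b\<close>.\<close>
    define c where "c = (b * x) ^ Suc m"
    have "c \<noteq> 0" using not_less_Least[of "Suc m" "\<lambda>k. (b * x) ^ k = 0"] m
      unfolding c_def k_def by simp
    moreover have c: "c = b * (x * (b * x) ^ m)" by (simp add: c_def mult.assoc)
    moreover have "c = a * (x0 * (x * (b * x) ^ m))" by (simp add: c b_def mult.assoc)
    ultimately have "ann c \<in> \<S>" unfolding \<S>_def by (metis (mono_tags, lifting) mem_Collect_eq)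
    moreover have "M \<subseteq> ann c"
      unfolding x0(1) b_def[symmetric] ann_def c by (auto simp: mult.assoc[symmetric])
    ultimately have "ann c = ann b" using M(2) x0(1) b_def by blast
    moreover have "b * x \<in> ann c" using k m by (simp add: ann_def c_def)
    ultimately show ?thesis by (simp add: ann_def)
  qed simp
  then have "b = 0 \<or> b = 0" by (rule prime)
  then show False using x0(2) b_def by simp
qed

text \<open>The lowest nonzero coefficient of the integral equation of \<open>z\<close> is a central
  unit. Solving for the lowest power gives \<open>w\<close> as a polynomial in \<open>z\<close> with
  central coefficients, which is why it commutes with \<open>z\<close>.\<close>

lemma integral_pi_regular:
  fixes z :: "'a::ring_1"
  assumes integral: "integral_over_center TYPE('a)"
    and units: "\<And>c :: 'a. c \<in> center \<Longrightarrow> c \<noteq> 0 \<Longrightarrow> \<exists>d. c * d = 1"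
  obtains s w where "z * w = w * z" "z ^ s = z ^ Suc s * w"
proof -
  obtain n and c :: "nat \<Rightarrow> 'a" where c: "\<And>i. i < n \<Longrightarrow> c i \<in> center"
    and rel: "z ^ n + (\<Sum>i<n. c i * z ^ i) = 0"
    using integral unfolding integral_over_center_def by blast
  \<comment> \<open>The leading coefficient 1 is included at index \<open>n\<close>, so a least
    index with nonzero coefficient always exists.\<close>
  define c' where "c' i = (if i < n then c i else 1)" for i
  have c'_center: "c' i \<in> center" for i using c by (simp add: c'_def center_def)
  then have c'_comm: "c' i * x = x * c' i" for i x by (simp add: center_def)
  have rel': "(\<Sum>i\<le>n. c' i * z ^ i) = 0"
    using rel by (simp add: c'_def atMost_Suc lessThan_Suc_atMost[symmetric] add.commute)
  define s where "s = (LEAST i. c' i \<noteq> 0)"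
  have "c' n \<noteq> 0" by (simp add: c'_def)
  then have s: "c' s \<noteq> 0" "s \<le> n"
    unfolding s_def by (fact LeastI, fact Least_le)
  have below: "c' i = 0" if "i < s" for i
    using not_less_Least[OF that[unfolded s_def]] by simp
  obtain d where d: "c' s * d = 1" using units[OF c'_center s(1)] by blast
  define v where "v = (\<Sum>i\<in>{Suc s..n}. c' i * z ^ (i - Suc s))"
  have "0 = (\<Sum>i\<in>{s..n}. c' i * z ^ i)"
    unfolding rel'[symmetric] by (rule sum.mono_neutral_right) (use below in auto)
  also have "\<dots> = c' s * z ^ s + (\<Sum>i\<in>{Suc s..n}. c' i * z ^ i)"
    using s(2) by (rule sum.atLeast_Suc_atMost)
  also have "(\<Sum>i\<in>{Suc s..n}. c' i * z ^ i) = z ^ Suc s * v"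
    unfolding v_def sum_distrib_left
  proof (rule sum.cong[OF refl])
    fix i assume "i \<in> {Suc s..n}"
    then have i: "Suc s + (i - Suc s) = i" by simp
    have "z ^ Suc s * (c' i * z ^ (i - Suc s)) = c' i * (z ^ Suc s * z ^ (i - Suc s))"
      by (simp only: mult.assoc[symmetric] c'_comm[of i "z ^ Suc s"])
    also have "\<dots> = c' i * z ^ i" unfolding power_add[symmetric] i ..
    finally show "c' i * z ^ i = z ^ Suc s * (c' i * z ^ (i - Suc s))" ..
  qed
  finally have 1: "c' s * z ^ s = z ^ Suc s * (- v)" by (simp add: eq_neg_iff_add_eq_0)
  have dx: "d * x = x * d" for x
  proof -
    have "d * x = d * x * (c' s * d)" by (simp add: d)
    also have "\<dots> = d * (x * c' s) * d" by (simp add: mult.assoc)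
    also have "\<dots> = d * (c' s * x) * d" by (simp only: c'_comm)
    also have "\<dots> = (c' s * d) * x * d" by (simp only: c'_comm[of s d] mult.assoc)
    finally show ?thesis by (simp add: d)
  qed
  have vz: "z * v = v * z"
    unfolding v_def sum_distrib_left sum_distrib_right
  proof (rule sum.cong[OF refl])
    fix i
    have "z * (c' i * z ^ (i - Suc s)) = c' i * (z * z ^ (i - Suc s))"
      by (simp only: mult.assoc[symmetric] c'_comm[of i z])
    then show "z * (c' i * z ^ (i - Suc s)) = c' i * z ^ (i - Suc s) * z"
      by (simp add: power_commutes mult.assoc)
  qed
  have "z ^ s = z ^ s * (c' s * d)" by (simp add: d)
  also have "\<dots> = (c' s * z ^ s) * d" by (simp add: c'_comm[of s "z ^ s"] mult.assoc)
  also have "\<dots> = z ^ Suc s * (- v * d)" unfolding 1 by (simp only: mult.assoc)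
  finally have "z ^ s = z ^ Suc s * (- v * d)" .
  moreover have "z * (- v * d) = (- v * d) * z"
    using vz dx[of z] by (simp add: mult.assoc) (simp add: mult.assoc[symmetric])
  ultimately show ?thesis using that by blast
qed

text \<open>A non-nilpotent \<open>z\<close> in the right ideal of \<open>y\<close> yields the
  idempotent \<open>e = z ^ t * w ^ t\<close>. It is nonzero because \<open>z\<close> is not
  nilpotent, and differs from 1 because \<open>y * e = 0\<close>; primeness then gives a nonzero
  Peirce component.\<close>

lemma square_zero_imp_maximal_subring:
  fixes y :: "'a::ring_1"
  assumes noeth: "left_noetherian TYPE('a)" and integral: "integral_over_center TYPE('a)"
    and prime: "\<And>a b :: 'a. (\<And>r. a * r * b = 0) \<Longrightarrow> a = 0 \<or> b = 0"
    and units: "\<And>c :: 'a. c \<in> center \<Longrightarrow> c \<noteq> 0 \<Longrightarrow> \<exists>d. c * d = 1"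
    and y: "y \<noteq> 0" "y * y = 0"
  shows "has_maximal_subring TYPE('a)"
proof -
  obtain x where x: "\<And>k. (y * x) ^ k \<noteq> 0"
    using nonzero_right_ideal_not_nil[OF noeth prime y(1)] by blast
  define z where "z = y * x"
  obtain s w where w: "z * w = w * z" "z ^ s = z ^ Suc s * w"
    using integral_pi_regular[OF integral units] .
  have zw: "z ^ i * w ^ j = w ^ j * z ^ i" for i j
    using power_commuting_commutes[OF power_commuting_commutes[OF w(1), symmetric], symmetric] .
  have shift: "z ^ t = z ^ (t + k) * w ^ k" if "t \<ge> s" for t k
  proof (induction k)
    case (Suc k)
    have "z ^ (t + k) = z ^ (t + k - s) * z ^ s" using that by (simp flip: power_add)
    also have "\<dots> = z ^ (t + k - s) * z ^ Suc s * w" by (simp only: w(2) mult.assoc)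
    also have "\<dots> = z ^ (t + Suc k) * w" using that by (simp only: flip: power_add) simp
    finally have "z ^ (t + k) = z ^ (t + Suc k) * w" .
    then have "z ^ (t + k) * w ^ k = z ^ (t + Suc k) * w ^ Suc k"
      by (simp only: power_Suc mult.assoc)
    then show ?case using Suc.IH by simp
  qed simp
  \<comment> \<open>The exponent must be positive, so that \<open>y * z = 0\<close> forces
    \<open>y * z ^ t = 0\<close>.\<close>
  define t where "t = Suc s"
  define e where "e = z ^ t * w ^ t"
  have zt: "z ^ t = z ^ t * e"
  proof -
    have "z ^ t = z ^ (t + t) * w ^ t" by (rule shift) (simp add: t_def)
    then show ?thesis by (simp only: e_def power_add mult.assoc)
  qed
  have idem: "e * e = e"
  proof -
    have e': "e = w ^ t * z ^ t" by (simp only: e_def zw)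
    have "e * e = w ^ t * (z ^ t * e)" by (subst (1) e') (rule mult.assoc)
    also have "\<dots> = e" by (simp only: zt[symmetric] e'[symmetric])
    finally show ?thesis .
  qed
  have "y * z = 0" using y(2) by (simp add: z_def mult.assoc[symmetric])
  then have "y * z ^ t = 0" by (simp add: t_def mult.assoc[symmetric])
  then have "y * e = 0" by (simp add: e_def mult.assoc[symmetric])
  then have "1 - e \<noteq> 0" using y(1) by auto
  moreover have "e \<noteq> 0" using zt x[of t] by (auto simp: z_def)
  ultimately obtain r where "(1 - e) * r * e \<noteq> 0" using prime by blast
  then show ?thesis using idempotent_imp_maximal_subring[OF noeth idem] by blast
qed

text \<open>Primeness supplies a nonzero \<open>b * r * a\<close>, whose square contains the factor
  \<open>a * b\<close>.\<close>

lemma zero_divisors_imp_maximal_subring: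
  fixes a b :: "'a::ring_1"
  assumes noeth: "left_noetherian TYPE('a)" and integral: "integral_over_center TYPE('a)"
    and prime: "\<And>a b :: 'a. (\<And>r. a * r * b = 0) \<Longrightarrow> a = 0 \<or> b = 0"
    and units: "\<And>c :: 'a. c \<in> center \<Longrightarrow> c \<noteq> 0 \<Longrightarrow> \<exists>d. c * d = 1"
    and ab: "a \<noteq> 0" "b \<noteq> 0" "a * b = 0"
  shows "has_maximal_subring TYPE('a)"
proof -
  obtain r where r: "b * r * a \<noteq> 0" using prime ab by blast
  have "b * r * a * (b * r * a) = b * r * (a * b) * r * a" by (simp add: mult.assoc)
  then have "b * r * a * (b * r * a) = 0" by (simp add: ab(3))
  then show ?thesis using square_zero_imp_maximal_subring[OF noeth integral prime units r] by blast
qed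

text \<open>Without zero divisors, \<open>z ^ s\<close> cancels from
  \<open>z ^ s = z ^ Suc s * w\<close> and leaves an inverse of \<open>z\<close>.\<close>

lemma division_or_maximal_subring:
  assumes noeth: "left_noetherian TYPE('a::ring_1)" and integral: "integral_over_center TYPE('a)"
    and prime: "\<And>a b :: 'a. (\<And>r. a * r * b = 0) \<Longrightarrow> a = 0 \<or> b = 0"
    and units: "\<And>c :: 'a. c \<in> center \<Longrightarrow> c \<noteq> 0 \<Longrightarrow> \<exists>d. c * d = 1"
    and no_max: "\<not> has_maximal_subring TYPE('a)" and "(z :: 'a) \<noteq> 0"
  shows "\<exists>w. z * w = 1 \<and> w * z = 1"
proof -
  have dom: "a = 0 \<or> b = 0" if "a * b = 0" for a b :: 'a
    using zero_divisors_imp_maximal_subring[OF noeth integral prime units _ _ that] no_max by blast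
  obtain s w where w: "z * w = w * z" "z ^ s = z ^ Suc s * w"
    using integral_pi_regular[OF integral units] .
  have "z ^ s \<noteq> 0" using dom \<open>z \<noteq> 0\<close> by (induction s) auto
  moreover have "z ^ s * (1 - z * w) = 0"
    using w(2) by (simp add: right_diff_distrib power_Suc2 mult.assoc del: power_Suc)
  ultimately have "1 - z * w = 0" using dom by blast
  then show ?thesis using w(1) by (metis eq_iff_diff_eq_0)
qed

section \<open>Rings all of whose proper quotients are small\<close>

lemma subring_center: "is_subring (center :: 'a::ring_1 set)"
  unfolding is_subring_def center_def
proof (intro conjI ballI CollectI allI)
  fix x y z :: 'a
  assume "x \<in> {c. \<forall>x. c * x = x * c}" "y \<in> {c. \<forall>x. c * x = x * c}"
  then have comm: "x * z = z * x" "y * z = z * y" by auto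
  show "(x - y) * z = z * (x - y)" by (simp add: left_diff_distrib right_diff_distrib comm)
  have "x * y * z = x * z * y" by (simp only: mult.assoc comm(2))
  then show "x * y * z = z * (x * y)" by (simp only: comm(1) mult.assoc)
qed simp

lemma centerD: "c \<in> center \<Longrightarrow> c * x = x * c"
  by (simp add: center_def)

lemma two_sided_ideal_center_multiples:
  assumes "c \<in> center" shows "two_sided_ideal (range ((*) c))"
  unfolding two_sided_ideal_def left_ideal_def
proof (intro conjI allI ballI)
  show "0 \<in> range ((*) c)" by (metis mult_zero_right rangeI)
  fix x assume "x \<in> range ((*) c)"
  then obtain u where u: "x = c * u" by blast
  show "r * x \<in> range ((*) c)" for r
  proof -
    have "r * x = c * (r * u)"
      by (simp only: u mult.assoc[symmetric] centerD[OF assms, of r])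
    then show ?thesis by blast
  qed
  show "x * r \<in> range ((*) c)" for r unfolding u mult.assoc by blast
  fix y assume "y \<in> range ((*) c)"
  then show "x - y \<in> range ((*) c)" unfolding u by (auto simp flip: right_diff_distrib)
qed

text \<open>\<open>B\<close> is the right annihilator of the ideal generated by \<open>a\<close>,
  and \<open>A\<close> is the left annihilator of \<open>B\<close>. If \<open>a\<close> and
  \<open>b\<close> were nonzero, both ideals would be nonzero, hence small, with product zero, and
  the whole ring would be small.\<close>

lemma minimal_large_prime:
  fixes a b :: "'a::ring_1"
  assumes noeth: "left_noetherian TYPE('a)" and large: "\<not> small_quotient {0 :: 'a}"
    and proper: "\<And>I :: 'a set. two_sided_ideal I \<Longrightarrow> I \<noteq> {0} \<Longrightarrow> small_quotient I"
    and ab: "\<And>r. a * r * b = 0"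
  shows "a = 0 \<or> b = 0"
proof (rule ccontr)
  assume nz: "\<not> ?thesis"
  define B where "B = {y. \<forall>r. a * r * y = 0}"
  define A where "A = {x. \<forall>y\<in>B. x * y = 0}"
  have assoc: "a * r * (s * y) = a * (r * s) * y" for r s y by (simp add: mult.assoc)
  have B: "two_sided_ideal B"
    unfolding two_sided_ideal_def left_ideal_def
  proof (intro conjI allI ballI)
    show "s * y \<in> B" if "y \<in> B" for s y using that by (simp add: B_def assoc del: mult_eq_0_iff)
    show "y * s \<in> B" if "y \<in> B" for s y
      using that unfolding B_def by (simp add: mult.assoc[symmetric])
  qed (auto simp: B_def right_diff_distrib)
  have A: "two_sided_ideal A"
    unfolding two_sided_ideal_def left_ideal_def
  proof (intro conjI allI ballI)
    show "x * s \<in> A" if "x \<in> A" for s x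
      using that B unfolding A_def two_sided_ideal_def left_ideal_def by (simp add: mult.assoc)
  qed (auto simp: A_def left_diff_distrib mult.assoc)
  have "b \<in> B" using ab by (simp add: B_def)
  have "a * y = 0" if "y \<in> B" for y using that by (auto simp: B_def dest: spec[of _ 1])
  then have "a \<in> A" by (simp add: A_def)
  have "small_quotient A" "small_quotient B"
    using proper[OF A] proper[OF B] \<open>a \<in> A\<close> \<open>b \<in> B\<close> nz by blast+
  then have "small_quotient {0 :: 'a}"
    by (rule small_quotient_product[OF noeth]) (use B in \<open>auto simp: A_def two_sided_ideal_def\<close>)
  then show False using large by blast
qed

text \<open>For a nonzero nonunit \<^term>\<open>c\<close> in the center, stationarity of the left ideals generated by the
  successive quotients by \<^term>\<open>c\<close> of an infinitely \<^term>\<open>c\<close>-divisible element yields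
  \<^term>\<open>x = t * c * x\<close>. An integral equation of \<^term>\<open>t\<close> turns this into
  \<^term>\<open>(1 + c * b) * x = 0\<close> with \<^term>\<open>b\<close> central, so no Krull intersection theorem is needed.\<close>

lemma minimal_large_center_field:
  fixes c :: "'a::ring_1"
  assumes noeth: "left_noetherian TYPE('a)" and integral: "integral_over_center TYPE('a)"
    and large: "\<not> small_quotient {0 :: 'a}"
    and proper: "\<And>I :: 'a set. two_sided_ideal I \<Longrightarrow> I \<noteq> {0} \<Longrightarrow> small_quotient I"
    and c: "c \<in> center" "c \<noteq> 0"
  shows "\<exists>d. c * d = 1"
proof (rule ccontr)
  assume nonunit: "\<not> ?thesis"
  have regular: "x = 0" if "u \<in> center" "u \<noteq> 0" "u * x = 0" for u x :: 'a
  proof -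
    have "u * r * x = r * (u * x)" for r by (simp only: centerD[OF that(1), of r] mult.assoc)
    then have "u * r * x = 0" for r by (simp add: that(3))
    then show ?thesis using minimal_large_prime[OF noeth large proper] that(2) by blast
  qed
  have "c * 1 \<in> range ((*) c)" by blast
  then have small: "small_quotient (range ((*) c))"
    using proper[OF two_sided_ideal_center_multiples[OF c(1)]] c(2) by force
  have "z 0 = 0" if z: "\<And>n. z n = c * z (Suc n)" for z :: "nat \<Rightarrow> 'a"
  proof -
    define L where "L n = range (\<lambda>r. r * z n)" for n
    have ideal: "left_ideal (L n)" for n
      unfolding left_ideal_def L_def
    proof (intro conjI ballI allI)
      show "0 \<in> range (\<lambda>r. r * z n)" by (metis mult_zero_left rangeI)
      fix x y assume "x \<in> range (\<lambda>r. r * z n)" "y \<in> range (\<lambda>r. r * z n)"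
      then show "x - y \<in> range (\<lambda>r. r * z n)" by (auto simp flip: left_diff_distrib)
    qed (auto simp flip: mult.assoc)
    have "r * z n = (r * c) * z (Suc n)" for r n using z[of n] by (simp add: mult.assoc)
    then have "L n \<subseteq> L (Suc n)" for n unfolding L_def by blast
    then obtain N where N: "\<And>m. m \<ge> N \<Longrightarrow> L m = L N"
      using noeth ideal unfolding left_noetherian_def by blast
    define x where "x = z (Suc N)"
    have "1 * x \<in> L (Suc N)" unfolding L_def x_def by blast
    then have "x \<in> L N" using N[of "Suc N"] by simp
    then obtain t where t: "x = t * z N" unfolding L_def by blast
    then have tcx: "c * (t * x) = x"
      using z[of N] centerD[OF c(1), of t] by (simp add: x_def mult.assoc[symmetric])
    have cpow: "c ^ j \<in> center" for j using subring_power[OF subring_center c(1)] .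
    have tx: "c ^ j * (t ^ j * x) = x" for j
    proof (induction j)
      case (Suc j)
      have "c ^ Suc j * (t ^ Suc j * x) = c ^ j * (c * t ^ j) * (t * x)"
        by (simp only: power_Suc2 mult.assoc)
      also have "\<dots> = c ^ j * (t ^ j * (c * (t * x)))"
        by (simp only: centerD[OF c(1), of "t ^ j"] mult.assoc)
      finally show ?case using Suc.IH tcx by simp
    qed simp
    obtain n and a :: "nat \<Rightarrow> 'a" where a: "\<And>i. i < n \<Longrightarrow> a i \<in> center"
      and rel: "t ^ n + (\<Sum>i<n. a i * t ^ i) = 0"
      using integral unfolding integral_over_center_def by blast
    \<comment> \<open>The integral equation of \<open>t\<close> is applied to \<open>x\<close> and
      multiplied by \<open>c ^ n\<close>; the leading term becomes \<open>x\<close>. In the term of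
      index \<open>i\<close>, \<open>c ^ i\<close> cancels \<open>t ^ i\<close>, one factor
      \<open>c\<close> is pulled out, and the remaining \<open>n - Suc i\<close> factors go into
      \<open>b\<close>.\<close>
    define b where "b = (\<Sum>i<n. a i * c ^ (n - Suc i))"
    have b: "b \<in> center" unfolding b_def
      using a cpow by (intro subring_sum subring_mult subring_center) auto
    have summand: "c ^ n * (a i * t ^ i * x) = c * (a i * c ^ (n - Suc i)) * x" if "i < n" for i
    proof -
      have n: "n = Suc (n - Suc i + i)" using that by simp
      have "c ^ n * (a i * t ^ i * x) = a i * (c ^ n * (t ^ i * x))"
        by (simp only: centerD[OF cpow, of n "a i"] mult.assoc[symmetric])
      also have "c ^ n * (t ^ i * x) = c * c ^ (n - Suc i) * (c ^ i * (t ^ i * x))"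
        by (subst n) (simp add: power_add mult.assoc)
      also have "\<dots> = c * c ^ (n - Suc i) * x" by (simp only: tx)
      also have "a i * (c * c ^ (n - Suc i) * x) = c * (a i * c ^ (n - Suc i)) * x"
        by (simp only: centerD[OF c(1), of "a i"] mult.assoc[symmetric])
      finally show ?thesis .
    qed
    have "0 = c ^ n * ((t ^ n + (\<Sum>i<n. a i * t ^ i)) * x)" by (simp add: rel)
    also have "\<dots> = x + (\<Sum>i<n. c ^ n * (a i * t ^ i * x))"
      by (simp add: distrib_left distrib_right sum_distrib_left sum_distrib_right tx)
    also have "(\<Sum>i<n. c ^ n * (a i * t ^ i * x)) = (\<Sum>i<n. c * (a i * c ^ (n - Suc i)) * x)"
      by (rule sum.cong) (use summand in auto)
    also have "x + \<dots> = (1 + c * b) * x"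
      by (simp add: b_def distrib_right sum_distrib_left sum_distrib_right)
    finally have "(1 + c * b) * x = 0" ..
    moreover have "1 + c * b \<in> center"
      using c(1) b by (intro subring_add subring_mult subring_one subring_center)
    moreover have "1 + c * b \<noteq> 0"
    proof
      assume "1 + c * b = 0"
      then have "c * (- b) = 1" by (simp add: eq_neg_iff_add_eq_0[symmetric] minus_equation_iff)
      then show False using nonunit by blast
    qed
    ultimately have "x = 0" using regular by blast
    have "z 0 = c ^ k * z k" for k
    proof (induction k)
      case (Suc k)
      then show ?case using z[of k] by (simp only: power_Suc2 mult.assoc)
    qed simp
    then show ?thesis using \<open>x = 0\<close> x_def by (metis mult_zero_right)
  qed
  then show False using small_quotient_adic[OF small] large by blast
qed

section \<open>Noncommutative division rings\<close>

text \<open>Gaussian elimination over a division ring, with coefficients on the left and unknowns on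
  the right: the last equation is used to eliminate one unknown.\<close>

lemma homogeneous_system_nontrivial_solution:
  fixes A :: "nat \<Rightarrow> 'i \<Rightarrow> 'a::ring_1"
  assumes inv: "\<And>x :: 'a. x \<noteq> 0 \<Longrightarrow> \<exists>w. x * w = 1"
    and "finite X" "n < card X"
  shows "\<exists>e. (\<exists>x\<in>X. e x \<noteq> 0) \<and> (\<forall>j<n. (\<Sum>x\<in>X. A j x * e x) = 0)"
  using assms(2,3)
proof (induction n arbitrary: A X)
  case 0
  then have "X \<noteq> {}" by auto
  then show ?case by (intro exI[of _ "\<lambda>_. 1"]) auto
next
  case (Suc n)
  show ?case
  proof (cases "\<forall>x\<in>X. A n x = 0")
    case True
    obtain e where e: "\<exists>x\<in>X. e x \<noteq> 0" "\<forall>j<n. (\<Sum>x\<in>X. A j x * e x) = 0"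
      using Suc.IH[of X A] Suc.prems by auto
    have "(\<Sum>x\<in>X. A n x * e x) = 0" using True by simp
    then show ?thesis using e by (auto simp: less_Suc_eq)
  next
    case False
    then obtain x0 where x0: "x0 \<in> X" "A n x0 \<noteq> 0" by blast
    obtain w where w: "A n x0 * w = 1" using inv[OF x0(2)] by blast
    \<comment> \<open>Row \<open>j\<close> minus the left multiple of row \<open>n\<close> that
      clears the column of the pivot \<open>x0\<close>.\<close>
    define B where "B j x = A j x - A j x0 * w * A n x" for j x
    have "\<exists>e. (\<exists>x\<in>X - {x0}. e x \<noteq> 0) \<and> (\<forall>j<n. (\<Sum>x\<in>X - {x0}. B j x * e x) = 0)"
      by (rule Suc.IH) (use Suc.prems x0 in auto)
    then obtain e where e: "\<exists>x\<in>X - {x0}. e x \<noteq> 0"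
      "\<And>j. j < n \<Longrightarrow> (\<Sum>x\<in>X - {x0}. B j x * e x) = 0" by blast
    define s where "s = (\<Sum>x\<in>X - {x0}. A n x * e x)"
    \<comment> \<open>The value at \<open>x0\<close> is forced by row \<open>n\<close>.\<close>
    define e' where "e' = e(x0 := - (w * s))"
    have split: "(\<Sum>x\<in>X. A j x * e' x) = - (A j x0 * w * s) + (\<Sum>x\<in>X - {x0}. A j x * e x)" for j
    proof -
      have "(\<Sum>x\<in>X - {x0}. A j x * e' x) = (\<Sum>x\<in>X - {x0}. A j x * e x)"
        by (rule sum.cong) (auto simp: e'_def)
      then show ?thesis using sum.remove[OF Suc.prems(1) x0(1), of "\<lambda>x. A j x * e' x"]
        by (simp add: e'_def mult.assoc)
    qed
    have "(\<Sum>x\<in>X. A j x * e' x) = 0" if "j < Suc n" for j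
    proof (cases "j = n")
      case True
      then show ?thesis using split[of n] w by (simp add: s_def)
    next
      case False
      then have "(\<Sum>x\<in>X - {x0}. B j x * e x) = 0" using e(2) that by simp
      then show ?thesis unfolding split[of j]
        by (simp add: B_def s_def left_diff_distrib sum_subtractf sum_distrib_left mult.assoc)
    qed
    moreover have "\<exists>x\<in>X. e' x \<noteq> 0" using e(1) by (auto simp: e'_def)
    ultimately show ?thesis by blast
  qed
qed

definition centralizer :: "'a::ring_1 \<Rightarrow> 'a set" where
  "centralizer a = {x. a * x = x * a}"

lemma subring_centralizer: "is_subring (centralizer a)"
  unfolding is_subring_def
proof (intro conjI ballI)
  show "1 \<in> centralizer a" by (simp add: centralizer_def)
  fix x y assume "x \<in> centralizer a" "y \<in> centralizer a"
  then have comm: "a * x = x * a" "a * y = y * a" by (auto simp: centralizer_def)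
  show "x - y \<in> centralizer a"
    by (simp add: centralizer_def left_diff_distrib right_diff_distrib comm)
  have "a * (x * y) = x * (a * y)" by (simp only: comm(1) mult.assoc[symmetric])
  then show "x * y \<in> centralizer a" by (simp add: centralizer_def comm(2) mult.assoc)
qed

text \<open>The argument of Artin's lemma: a solution of \<open>\<Sum>x\<in>X. x * a ^ j * e x = 0\<close> of minimal support
  with a coefficient 1 commutes with \<^term>\<open>a\<close>, as otherwise its commutator with \<^term>\<open>a\<close> would
  be a solution of smaller support.\<close>

lemma centralizer_dependent:
  fixes a :: "'a::ring_1"
  assumes inv: "\<And>x :: 'a. x \<noteq> 0 \<Longrightarrow> \<exists>w. x * w = 1"
    and c: "\<And>i. i < n \<Longrightarrow> c i \<in> center" and rel: "a ^ n + (\<Sum>i<n. c i * a ^ i) = 0"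
    and X: "finite X" "n < card X"
  shows "\<exists>e. (\<forall>x\<in>X. e x \<in> centralizer a) \<and> (\<exists>x\<in>X. e x \<noteq> 0) \<and> (\<Sum>x\<in>X. x * e x) = 0"
proof -
  \<comment> \<open>Imposing the equations for all \<open>j\<close> makes the solutions stable under
    commutators with \<open>a\<close>: a factor \<open>a\<close> to the left of \<open>e x\<close>
    merely raises \<open>j\<close> by one.\<close>
  define sol where "sol e \<longleftrightarrow> (\<forall>j. (\<Sum>x\<in>X. x * a ^ j * e x) = 0)" for e
  define supp where "supp e = {x \<in> X. e x \<noteq> 0}" for e :: "'a \<Rightarrow> 'a"
  obtain e0 where e0: "\<exists>x\<in>X. e0 x \<noteq> 0" "\<And>j. j < n \<Longrightarrow> (\<Sum>x\<in>X. x * a ^ j * e0 x) = 0"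
    using homogeneous_system_nontrivial_solution[OF inv X, of "\<lambda>j x. x * a ^ j"] by blast
  \<comment> \<open>From \<open>n\<close> on, the monic relation rewrites \<open>a ^ j\<close>
    through lower powers with central coefficients, so the first \<open>n\<close> equations imply
    all others.\<close>
  have "(\<Sum>x\<in>X. x * a ^ j * e0 x) = 0" for j
  proof (induction j rule: less_induct)
    case (less j)
    show ?case
    proof (cases "j < n")
      case False
      then have j: "j = n + (j - n)" by simp
      have move: "x * (c i * u) * v = c i * (x * u * v)" if "i < n" for x u v i
        by (simp only: mult.assoc[symmetric] centerD[OF c[OF that], of x])
      have "a ^ n = - (\<Sum>i<n. c i * a ^ i)" using rel by (simp add: eq_neg_iff_add_eq_0)
      then have "a ^ j = - (\<Sum>i<n. c i * a ^ i) * a ^ (j - n)" by (subst j) (simp add: power_add)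
      also have "\<dots> = - (\<Sum>i<n. c i * a ^ (i + (j - n)))"
        by (simp add: sum_distrib_right mult.assoc power_add)
      finally have aj: "a ^ j = - (\<Sum>i<n. c i * a ^ (i + (j - n)))" .
      have "(\<Sum>x\<in>X. x * a ^ j * e0 x) = - (\<Sum>x\<in>X. \<Sum>i<n. x * (c i * a ^ (i + (j - n))) * e0 x)"
        unfolding aj by (simp add: sum_distrib_left sum_distrib_right sum_negf)
      also have "(\<Sum>x\<in>X. \<Sum>i<n. x * (c i * a ^ (i + (j - n))) * e0 x)
          = (\<Sum>i<n. c i * (\<Sum>x\<in>X. x * a ^ (i + (j - n)) * e0 x))"
        unfolding sum_distrib_left
        by (subst sum.swap) (intro sum.cong refl move, simp)
      also have "\<dots> = 0" using less.IH False by (intro sum.neutral) auto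
      finally show ?thesis by simp
    qed (use e0 in simp)
  qed
  then have "sol e0 \<and> supp e0 \<noteq> {}" using e0(1) by (auto simp: sol_def supp_def)
  then obtain e where e: "sol e" "supp e \<noteq> {}"
    and least: "\<And>e'. sol e' \<Longrightarrow> supp e' \<noteq> {} \<Longrightarrow> card (supp e) \<le> card (supp e')"
    using ex_has_least_nat[of "\<lambda>e. sol e \<and> supp e \<noteq> {}" e0 "\<lambda>e. card (supp e)"] by blast
  then obtain x0 where x0: "x0 \<in> X" "e x0 \<noteq> 0" by (auto simp: supp_def)
  obtain w where w: "e x0 * w = 1" using inv[OF x0(2)] by blast
  define f where "f x = e x * w" for x
  define g where "g x = a * f x - f x * a" for x
  have f: "(\<Sum>x\<in>X. x * a ^ j * f x) = 0" for j
    using e(1) by (simp add: sol_def f_def mult.assoc[symmetric] flip: sum_distrib_right)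
  have "(\<Sum>x\<in>X. x * a ^ j * g x) = (\<Sum>x\<in>X. x * a ^ Suc j * f x) - (\<Sum>x\<in>X. x * a ^ j * f x) * a" for j
    by (simp add: g_def right_diff_distrib sum_subtractf sum_distrib_right power_Suc2 mult.assoc
        del: power_Suc)
  then have g: "sol g" using f by (simp add: sol_def del: power_Suc)
  have "supp g \<subset> supp e"
  proof -
    have "g x0 = 0" by (simp add: g_def f_def w)
    then show ?thesis using x0 by (auto simp: supp_def g_def f_def)
  qed
  then have "card (supp g) < card (supp e)" using X(1) by (intro psubset_card_mono) (auto simp: supp_def)
  then have "supp g = {}" using least[OF g] by (metis not_le)
  then have "\<forall>x\<in>X. f x \<in> centralizer a" by (auto simp: supp_def g_def centralizer_def)
  moreover have "f x0 \<noteq> 0" by (simp add: f_def w)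
  moreover have "(\<Sum>x\<in>X. x * f x) = 0" using f[of 0] by simp
  ultimately show ?thesis using x0(1) by blast
qed

text \<open>The degree of the integral equation of \<open>a\<close> bounds the size of sets
  independent over the centralizer of \<open>a\<close>, with scalars acting on the right. An
  independent set of greatest size spans, and so generates the ring over the centralizer.\<close>

lemma noncommutative_division_imp_maximal_subring:
  fixes a b :: "'a::ring_1"
  assumes integral: "integral_over_center TYPE('a)"
    and inv: "\<And>x :: 'a. x \<noteq> 0 \<Longrightarrow> \<exists>w. x * w = 1 \<and> w * x = 1"
    and ab: "a * b \<noteq> b * a"
  shows "has_maximal_subring TYPE('a)"
proof -
  obtain n and c :: "nat \<Rightarrow> 'a" where c: "\<And>i. i < n \<Longrightarrow> c i \<in> center"
    and rel: "a ^ n + (\<Sum>i<n. c i * a ^ i) = 0"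
    using integral unfolding integral_over_center_def by blast
  let ?E = "centralizer a"
  define indep where "indep X \<longleftrightarrow> finite X \<and>
    (\<forall>e. (\<forall>x\<in>X. e x \<in> ?E) \<and> (\<Sum>x\<in>X. x * e x) = 0 \<longrightarrow> (\<forall>x\<in>X. e x = 0))" for X
  have right_inv: "\<exists>w. x * w = 1" if "x \<noteq> 0" for x :: 'a using inv[OF that] by blast
  have "card X < Suc n" if X: "indep X" for X
  proof (rule ccontr)
    assume "\<not> card X < Suc n"
    then have "\<exists>e. (\<forall>x\<in>X. e x \<in> ?E) \<and> (\<exists>x\<in>X. e x \<noteq> 0) \<and> (\<Sum>x\<in>X. x * e x) = 0"
      using X by (intro centralizer_dependent[OF right_inv c rel]) (auto simp: indep_def)
    then show False using X unfolding indep_def by blast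
  qed
  moreover have "indep {}" by (simp add: indep_def)
  ultimately obtain X where X: "indep X" and max: "\<And>Y. indep Y \<Longrightarrow> card Y \<le> card X"
    using ex_has_greatest_nat[of indep "{}" card "Suc n"] by blast
  have fin: "finite X" using X by (simp add: indep_def)
  show ?thesis
  proof (rule finitely_generated_imp_maximal_subring[OF subring_centralizer _ fin])
    show "?E \<noteq> UNIV" using ab by (auto simp: centralizer_def)
    fix S assume S: "is_subring S" "?E \<subseteq> S" "X \<subseteq> S"
    have "y \<in> S" for y
    proof (cases "y \<in> X")
      case False
      then have "\<not> indep (insert y X)" using max[of "insert y X"] fin by auto
      then obtain e where e: "\<And>x. x \<in> insert y X \<Longrightarrow> e x \<in> ?E" "(\<Sum>x\<in>insert y X. x * e x) = 0"
        "\<exists>x\<in>insert y X. e x \<noteq> 0"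
        unfolding indep_def using fin by blast
      have sum: "y * e y + (\<Sum>x\<in>X. x * e x) = 0" using e(2) False fin by simp
      have "e y \<noteq> 0"
      proof
        assume "e y = 0"
        then have "\<forall>x\<in>X. e x = 0" using X sum e(1) unfolding indep_def by auto
        then show False using e(3) \<open>e y = 0\<close> by auto
      qed
      then obtain w where w: "e y * w = 1" "w * e y = 1" using inv by blast
      have ey: "a * e y = e y * a" using e(1) by (simp add: centralizer_def)
      have "a * w = w * (e y * a) * w" by (simp add: w mult.assoc[symmetric])
      also have "\<dots> = w * a * (e y * w)" by (simp only: ey[symmetric] mult.assoc)
      finally have "w \<in> ?E" by (simp add: w centralizer_def)
      then have "(\<Sum>x\<in>X. x * (e x * w)) \<in> S"
        using S e(1) by (intro subring_sum subring_mult) auto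
      moreover have "y = - (\<Sum>x\<in>X. x * (e x * w))"
      proof -
        have "y = y * e y * w" by (simp add: w mult.assoc)
        also have "y * e y = - (\<Sum>x\<in>X. x * e x)" using sum by (simp add: eq_neg_iff_add_eq_0)
        finally show ?thesis by (simp add: sum_distrib_right mult.assoc)
      qed
      ultimately show ?thesis using subring_uminus[OF S(1)] by metis
    qed (use S in blast)
    then show "S = UNIV" by blast
  qed
qed

section \<open>Adjoining an element to a subring of a commutative ring\<close>

text \<open>Subrings are sets and not types, so their polynomials are cut out of
  \<open>'a poly\<close> by a condition on coefficients.\<close>

definition polys_over :: "'a::comm_ring_1 set \<Rightarrow> 'a poly set" where
  "polys_over k = {p. \<forall>i. coeff p i \<in> k}"

definition adjoin :: "'a::comm_ring_1 set \<Rightarrow> 'a \<Rightarrow> 'a set" where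
  "adjoin k x = (\<lambda>p. poly p x) ` polys_over k"

lemma subring_polys_over:
  assumes "is_subring k" shows "is_subring (polys_over k)"
  unfolding is_subring_def
proof (intro conjI ballI)
  show "1 \<in> polys_over k"
    using assms by (auto simp: polys_over_def subring_zero subring_one one_pCons coeff_pCons split: nat.split)
  fix p q assume "p \<in> polys_over k" "q \<in> polys_over k"
  then show "p - q \<in> polys_over k" "p * q \<in> polys_over k"
    by (auto simp: polys_over_def coeff_mult intro!: subring_diff[OF assms]
        subring_sum[OF assms] subring_mult[OF assms])
qed

lemma subring_adjoin:
  assumes "is_subring k" shows "is_subring (adjoin k x)"
  unfolding is_subring_def
proof (intro conjI ballI)
  note sub = subring_polys_over[OF assms]
  show "1 \<in> adjoin k x"
    unfolding adjoin_def by (rule image_eqI[OF _ subring_one[OF sub]]) simp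
  fix a b assume "a \<in> adjoin k x" "b \<in> adjoin k x"
  then obtain p q where pq: "p \<in> polys_over k" "q \<in> polys_over k" "a = poly p x" "b = poly q x"
    unfolding adjoin_def by blast
  show "a - b \<in> adjoin k x"
    unfolding adjoin_def by (rule image_eqI[OF _ subring_diff[OF sub pq(1,2)]]) (simp add: pq)
  show "a * b \<in> adjoin k x"
    unfolding adjoin_def by (rule image_eqI[OF _ subring_mult[OF sub pq(1,2)]]) (simp add: pq)
qed

lemma adjoin_superset:
  assumes "is_subring k" shows "k \<subseteq> adjoin k x"
proof
  fix a assume "a \<in> k"
  then have "[:a:] \<in> polys_over k"
    using assms by (auto simp: polys_over_def coeff_pCons subring_zero split: nat.split)
  then show "a \<in> adjoin k x" unfolding adjoin_def by (rule rev_image_eqI) simp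
qed

lemma adjoin_generator:
  assumes "is_subring k" shows "x \<in> adjoin k x"
proof -
  have "[:0, 1:] \<in> polys_over k"
    using assms by (auto simp: polys_over_def coeff_pCons subring_zero subring_one split: nat.split)
  then show ?thesis unfolding adjoin_def by (rule rev_image_eqI) simp
qed

text \<open>Here \<open>t\<close> is the order of vanishing of \<open>q\<close> at 0 and
  \<open>s\<close> its lowest nonzero coefficient.\<close>

lemma poly_over_factor_power:
  assumes "q \<in> polys_over k" "q \<noteq> 0"
  shows "\<exists>t s b. s \<in> k \<and> s \<noteq> 0 \<and> b \<in> adjoin k x \<and> poly q x = x ^ t * (s + x * b)"
  using assms
proof (induction q)
  case (pCons a q)
  have a: "a \<in> k" using pCons.prems(1) by (auto simp: polys_over_def dest: spec[of _ 0])
  have q: "q \<in> polys_over k"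
    unfolding polys_over_def
  proof (intro CollectI allI)
    show "coeff q i \<in> k" for i
      using pCons.prems(1) by (auto simp: polys_over_def dest: spec[of _ "Suc i"])
  qed
  show ?case
  proof (cases "a = 0")
    case True
    then obtain t s b where "s \<in> k" "s \<noteq> 0" "b \<in> adjoin k x" "poly q x = x ^ t * (s + x * b)"
      using pCons.IH q pCons.prems(2) by auto
    then show ?thesis using True by (intro exI[of _ "Suc t"] exI[of _ s] exI[of _ b]) (simp add: mult.assoc)
  next
    case False
    have "poly q x \<in> adjoin k x" using q by (simp add: adjoin_def)
    then show ?thesis using False a by (intro exI[of _ 0] exI[of _ a] exI[of _ "poly q x"]) simp
  qed
qed simp

section \<open>Fields\<close>

text \<open>A field with a transcendental element has a maximal subring: with \<^term>\<open>k\<close> maximal such that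
  \<^term>\<open>x\<close> is transcendental over \<^term>\<open>k\<close>, every element is algebraic over \<^term>\<open>adjoin k x\<close>. A
  subring \<^term>\<open>V\<close> containing \<^term>\<open>k\<close> and \<^term>\<open>x\<close> that is maximal with
  \<open>x V \<inter> (k - {0}) = {}\<close> is a valuation ring, and algebraicity makes its valuation archimedean,
  so that \<^term>\<open>V\<close> and the inverse of \<^term>\<open>x\<close> generate the field.\<close>

definition transcendental_over :: "'a::comm_ring_1 set \<Rightarrow> 'a \<Rightarrow> bool" where
  "transcendental_over k x \<longleftrightarrow> (\<forall>p\<in>polys_over k. poly p x = 0 \<longrightarrow> p = 0)"

lemma maximal_transcendental_subring:
  assumes "is_subring k0" "transcendental_over k0 x"
  obtains k where "is_subring k" "transcendental_over k x"
    "\<And>k'. is_subring k' \<Longrightarrow> transcendental_over k' x \<Longrightarrow> k \<subseteq> k' \<Longrightarrow> k' = k"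
proof -
  let ?A = "{k. is_subring k \<and> transcendental_over k x}"
  have "\<exists>M\<in>?A. \<forall>k\<in>?A. M \<subseteq> k \<longrightarrow> k = M"
  proof (rule subset_Zorn_nonempty)
    show "?A \<noteq> {}" using assms by blast
    fix \<C> assume C: "\<C> \<noteq> {}" "subset.chain ?A \<C>"
    then have sub: "\<C> \<subseteq> ?A" by (simp add: subset_chain_def)
    have "is_subring (\<Union>\<C>)" using C sub by (intro subring_Union_chain) auto
    moreover have "transcendental_over (\<Union>\<C>) x"
      unfolding transcendental_over_def
    proof (intro ballI impI)
      fix p assume p: "p \<in> polys_over (\<Union>\<C>)" "poly p x = 0"
      have "coeff p ` {..degree p} \<subseteq> \<Union>\<C>" using p(1) by (auto simp: polys_over_def)
      then obtain S where S: "S \<in> \<C>" "coeff p ` {..degree p} \<subseteq> S"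
        using finite_subset_Union_chain[OF _ _ C] by (metis finite_atMost finite_imageI)
      then have "coeff p i \<in> S" for i
        using sub subring_zero[of S] coeff_eq_0[of p i] by (cases "i \<le> degree p") (auto simp: not_le)
      then have "p \<in> polys_over S" by (simp add: polys_over_def)
      then show "p = 0" using S(1) sub p(2) unfolding transcendental_over_def by blast
    qed
    ultimately show "\<Union>\<C> \<in> ?A" by blast
  qed
  then show ?thesis using that by blast
qed

text \<open>If \<open>w\<close> is not in \<open>k\<close>, maximality makes \<open>x\<close>
  algebraic over \<open>adjoin k w\<close>. Sorting the relation by powers of \<open>w\<close> gives
  an equation for \<open>w\<close>, nontrivial because \<open>x\<close> is transcendental over
  \<open>k\<close>. Cancelling powers of \<open>w\<close> makes its constant term nonzero.\<close>

lemma algebraic_over_adjoin: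
  fixes w x :: "'a::comm_ring_1"
  assumes k: "is_subring k" and trans: "transcendental_over k x"
    and max: "\<And>k'. is_subring k' \<Longrightarrow> transcendental_over k' x \<Longrightarrow> k \<subseteq> k' \<Longrightarrow> k' = k"
    and w: "\<And>y. w * y = 0 \<Longrightarrow> y = 0"
  shows "\<exists>n a. (\<forall>j. a j \<in> adjoin k x) \<and> a 0 \<noteq> 0 \<and> (\<Sum>j\<le>n. a j * w ^ j) = 0"
proof -
  note sub = subring_adjoin[OF k, of x]
  have "\<exists>n a j0. (\<forall>j. a j \<in> adjoin k x) \<and> j0 \<le> n \<and> a j0 \<noteq> 0 \<and> (\<Sum>j\<le>n. a j * w ^ j) = 0"
  proof (cases "w \<in> k")
    case True
    then have "- w \<in> adjoin k x" using adjoin_superset[OF k] sub by (blast intro: subring_uminus)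
    then show ?thesis
      using subring_one[OF sub]
      by (intro exI[of _ "Suc 0"] exI[of _ "\<lambda>j. if j = 0 then - w else 1"] exI[of _ "Suc 0"]) auto
  next
    case False
    then have "adjoin k w \<noteq> k" using adjoin_generator[OF k] by metis
    then have "\<not> transcendental_over (adjoin k w) x"
      using max[OF subring_adjoin[OF k] _ adjoin_superset[OF k]] by blast
    then obtain p where p: "p \<in> polys_over (adjoin k w)" "poly p x = 0" "p \<noteq> 0"
      unfolding transcendental_over_def by blast
    then have "\<exists>r. r \<in> polys_over k \<and> coeff p i = poly r w" for i
      by (auto simp: polys_over_def adjoin_def)
    then obtain r where r: "\<And>i. r i \<in> polys_over k" "\<And>i. coeff p i = poly (r i) w" by metis
    define d where "d = degree p"
    define N where "N = Max ((\<lambda>i. degree (r i)) ` {..d})"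
    have N: "degree (r i) \<le> N" if "i \<le> d" for i
      unfolding N_def using that by (intro Max_ge) auto
    \<comment> \<open>Transposes the array of coefficients: \<open>q j\<close>, evaluated at
      \<open>x\<close>, is the coefficient of \<open>w ^ j\<close>. The degree of the leading
      coefficient \<open>r d\<close> will locate a nonzero \<open>q j\<close>.\<close>
    define q where "q j = (\<Sum>i\<le>d. monom (coeff (r i) j) i)" for j
    have coeff_q: "coeff (q j) i = (if i \<le> d then coeff (r i) j else 0)" for i j
      by (simp add: q_def coeff_sum)
    have q: "q j \<in> polys_over k" for j
      using r(1) subring_zero[OF k] by (simp add: polys_over_def coeff_q)
    have "coeff p d \<noteq> 0" using p(3) by (simp add: d_def)
    then have rd: "r d \<noteq> 0" using r(2)[of d] by auto
    define j0 where "j0 = degree (r d)"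
    have "coeff (q j0) d \<noteq> 0" using rd by (simp add: coeff_q j0_def)
    then have "q j0 \<noteq> 0" by auto
    then have "poly (q j0) x \<noteq> 0" using q trans unfolding transcendental_over_def by blast
    moreover have "j0 \<le> N" unfolding j0_def using N by simp
    moreover have "(\<Sum>j\<le>N. poly (q j) x * w ^ j) = 0"
    proof -
      have "(\<Sum>j\<le>N. poly (q j) x * w ^ j) = (\<Sum>j\<le>N. \<Sum>i\<le>d. coeff (r i) j * w ^ j * x ^ i)"
        by (simp add: q_def poly_sum poly_monom sum_distrib_left sum_distrib_right mult_ac)
      also have "\<dots> = (\<Sum>i\<le>d. (\<Sum>j\<le>N. coeff (r i) j * w ^ j) * x ^ i)"
        by (subst sum.swap) (simp add: sum_distrib_right)
      also have "\<dots> = (\<Sum>i\<le>d. coeff p i * x ^ i)"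
      proof (intro sum.cong refl)
        fix i assume "i \<in> {..d}"
        then have "poly (r i) w = (\<Sum>j\<le>N. coeff (r i) j * w ^ j)"
          unfolding poly_altdef using N[of i]
          by (intro sum.mono_neutral_left) (auto simp: coeff_eq_0)
        then show "(\<Sum>j\<le>N. coeff (r i) j * w ^ j) * x ^ i = coeff p i * x ^ i" by (simp add: r(2))
      qed
      also have "\<dots> = poly p x" by (simp add: poly_altdef d_def)
      finally show ?thesis using p(2) by simp
    qed
    moreover have "poly (q j) x \<in> adjoin k x" for j using q by (simp add: adjoin_def)
    ultimately show ?thesis
      by (intro exI[of _ N] exI[of _ "\<lambda>j. poly (q j) x"] exI[of _ j0]) auto
  qed
  then obtain n a j0 where a: "\<And>j. a j \<in> adjoin k x" "j0 \<le> n" "a j0 \<noteq> 0"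
    "(\<Sum>j\<le>n. a j * w ^ j) = 0" by blast
  then show ?thesis
  \<comment> \<open>\<open>j0\<close> is the position of a nonzero coefficient; it drops by one each
    time a factor \<open>w\<close> is cancelled.\<close>
  proof (induction j0 arbitrary: a n)
    case (Suc j0)
    show ?case
    proof (cases "a 0 = 0")
      case True
      obtain m where m: "n = Suc m" using Suc.prems(2) by (cases n) auto
      have "(\<Sum>j\<le>n. a j * w ^ j) = w * (\<Sum>j\<le>m. a (Suc j) * w ^ j)"
        unfolding m sum.atMost_Suc_shift by (simp add: True sum_distrib_left mult_ac)
      then have "(\<Sum>j\<le>m. a (Suc j) * w ^ j) = 0" using w Suc.prems(4) by simp
      then show ?thesis using Suc.IH[of "\<lambda>j. a (Suc j)" m] Suc.prems m by simp
    qed (use Suc.prems in blast)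
  qed blast
qed

text \<open>Let \<open>v\<close> be the inverse of \<open>t = s - x * b\<close>. If \<open>v\<close>
  were outside \<open>V\<close>, some \<open>b'\<close> in \<open>adjoin V v\<close> would satisfy
  \<open>x * b' \<in> S\<close>. A power of \<open>t\<close> clears the powers of \<open>v\<close>
  in \<open>b'\<close>, and the same power of \<open>s\<close> agrees with it modulo multiples of
  \<open>x\<close>; hence \<open>s ^ N * (x * b')\<close> would be an element of \<open>S\<close> of
  the avoided form.\<close>

lemma maximal_avoiding_unit:
  fixes V S :: "'a::comm_ring_1 set"
  assumes inv: "\<And>x :: 'a. x \<noteq> 0 \<Longrightarrow> \<exists>w. x * w = 1"
    and V: "is_subring V" "x \<in> V" "S \<subseteq> V"
    and S: "1 \<in> S" "\<And>s t. s \<in> S \<Longrightarrow> t \<in> S \<Longrightarrow> s * t \<in> S"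
    and avoid: "\<And>b. b \<in> V \<Longrightarrow> x * b \<notin> S"
    and max: "\<And>V'. is_subring V' \<Longrightarrow> V \<subseteq> V' \<Longrightarrow> (\<And>b. b \<in> V' \<Longrightarrow> x * b \<notin> S) \<Longrightarrow> V' = V"
    and sb: "s \<in> S" "b \<in> V"
  shows "\<exists>v\<in>V. (s - x * b) * v = 1"
proof -
  define t where "t = s - x * b"
  have "t \<noteq> 0" using avoid[OF sb(2)] sb(1) by (auto simp: t_def)
  then obtain v where v: "t * v = 1" using inv by blast
  have tV: "t \<in> V" unfolding t_def
    using V sb by (intro subring_diff[OF V(1)] subring_mult[OF V(1)]) auto
  have "v \<in> V"
  proof (rule ccontr)
    assume "v \<notin> V"
    then have "adjoin V v \<noteq> V" using adjoin_generator[OF V(1)] by metis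
    then obtain b' where b': "b' \<in> adjoin V v" "x * b' \<in> S"
      using max[OF subring_adjoin[OF V(1)] adjoin_superset[OF V(1)]] by blast
    then obtain p where p: "p \<in> polys_over V" "b' = poly p v" unfolding adjoin_def by blast
    define N where "N = degree p"
    have tv: "t ^ N * v ^ i = t ^ (N - i)" if "i \<le> N" for i
    proof -
      have "t ^ N = t ^ (N - i) * t ^ i" using that by (simp flip: power_add)
      then show ?thesis using v by (simp add: mult.assoc flip: power_mult_distrib)
    qed
    have "t ^ N * b' = (\<Sum>i\<le>N. coeff p i * (t ^ N * v ^ i))"
      unfolding p(2) poly_altdef N_def by (simp add: sum_distrib_left mult_ac)
    also have "\<dots> = (\<Sum>i\<le>N. coeff p i * t ^ (N - i))" by (simp add: tv)
    also have "\<dots> \<in> V"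
      using p(1) subring_power[OF V(1) tV]
      by (intro subring_sum[OF V(1)] subring_mult[OF V(1)]) (auto simp: polys_over_def)
    finally have c: "t ^ N * b' \<in> V" .
    have "\<exists>y\<in>V. s ^ n - t ^ n = x * y" for n
    proof (induction n)
      case 0
      show ?case by (intro bexI[of _ 0] subring_zero[OF V(1)]) simp
    next
      case (Suc n)
      then obtain y where y: "y \<in> V" "s ^ n - t ^ n = x * y" by blast
      have "s ^ Suc n - t ^ Suc n = s * (s ^ n - t ^ n) + (s - t) * t ^ n" by (simp add: algebra_simps)
      also have "s - t = x * b" by (simp add: t_def)
      also have "s * (s ^ n - t ^ n) + x * b * t ^ n = x * (s * y + b * t ^ n)"
        by (simp only: y(2) distrib_left mult_ac)
      finally show ?case
        using V(3) sb y(1) subring_power[OF V(1) tV, of n]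
        by (intro bexI[of _ "s * y + b * t ^ n"] subring_add[OF V(1)] subring_mult[OF V(1)]) auto
    qed
    then obtain y where y: "y \<in> V" "s ^ N - t ^ N = x * y" by blast
    have "s ^ n \<in> S" for n using S sb(1) by (induction n) auto
    then have "s ^ N * (x * b') \<in> S" using S(2) b'(2) by blast
    moreover have "s ^ N * (x * b') = x * (t ^ N * b' + y * (x * b'))"
    proof -
      have "s ^ N = t ^ N + x * y" using y(2) by (simp add: algebra_simps)
      then show ?thesis by (simp add: algebra_simps)
    qed
    moreover have "t ^ N * b' + y * (x * b') \<in> V"
      using c y(1) b'(2) V(3) by (intro subring_add[OF V(1)] subring_mult[OF V(1) y(1)]) auto
    ultimately show False using avoid by metis
  qed
  then show ?thesis using v by (auto simp: t_def)
qed

text \<open>If \<open>z\<close> and \<open>z'\<close> both lay outside \<open>V\<close>, each would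
  have a polynomial over \<open>V\<close> whose value times \<open>x\<close> lies in
  \<open>S\<close>; take both of minimal degree. The one of smaller degree, multiplied by a power of
  the other variable, expresses the top power in the longer one through lower powers, since
  \<open>s - x * d 0\<close> is a unit of \<open>V\<close>. So the larger degree was not
  minimal.\<close>

lemma maximal_avoiding_valuation:
  fixes V S :: "'a::comm_ring_1 set"
  assumes inv: "\<And>x :: 'a. x \<noteq> 0 \<Longrightarrow> \<exists>w. x * w = 1"
    and V: "is_subring V" "x \<in> V" "S \<subseteq> V"
    and S: "1 \<in> S" "\<And>s t. s \<in> S \<Longrightarrow> t \<in> S \<Longrightarrow> s * t \<in> S"
    and avoid: "\<And>b. b \<in> V \<Longrightarrow> x * b \<notin> S"
    and max: "\<And>V'. is_subring V' \<Longrightarrow> V \<subseteq> V' \<Longrightarrow> (\<And>b. b \<in> V' \<Longrightarrow> x * b \<notin> S) \<Longrightarrow> V' = V"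
    and z: "z * z' = 1"
  shows "z \<in> V \<or> z' \<in> V"
proof (rule ccontr)
  assume notin: "\<not> ?thesis"
  define good where
    "good u m \<longleftrightarrow> (\<exists>c. (\<forall>i. c i \<in> V) \<and> x * (\<Sum>i\<le>m. c i * u ^ i) \<in> S)" for u m
  have ex: "\<exists>m. good u m" if "u \<notin> V" for u
  proof -
    have "adjoin V u \<noteq> V" using adjoin_generator[OF V(1)] that by metis
    then obtain b where b: "b \<in> adjoin V u" "x * b \<in> S"
      using max[OF subring_adjoin[OF V(1)] adjoin_superset[OF V(1)]] by blast
    then obtain p where "p \<in> polys_over V" "b = poly p u" unfolding adjoin_def by blast
    then show ?thesis using b(2) unfolding good_def
      by (intro exI[of _ "degree p"] exI[of _ "coeff p"]) (auto simp: poly_altdef polys_over_def)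
  qed
  have reduce: "\<exists>m'<m. good u m'"
    if u: "u * u' = 1" and m: "good u m" and l: "good u' l" "l \<le> m" for u u' m l
  proof -
    obtain b where b: "\<And>i. b i \<in> V" "x * (\<Sum>i\<le>m. b i * u ^ i) \<in> S"
      using m unfolding good_def by blast
    obtain c where c: "\<And>i. c i \<in> V" "x * (\<Sum>i\<le>l. c i * u' ^ i) \<in> S"
      using l(1) unfolding good_def by blast
    \<comment> \<open>Padding with zeros brings the relation for \<open>u'\<close> to formal degree
      \<open>m\<close>, ready for multiplication by \<open>u ^ m\<close>.\<close>
    define d where "d i = (if i \<le> l then c i else 0)" for i
    have d: "d i \<in> V" for i using c(1) subring_zero[OF V(1)] by (simp add: d_def)
    define s where "s = x * (\<Sum>i\<le>m. d i * u' ^ i)"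
    have "(\<Sum>i\<le>l. c i * u' ^ i) = (\<Sum>i\<le>m. d i * u' ^ i)"
      using \<open>l \<le> m\<close> by (intro sum.mono_neutral_cong_left) (auto simp: d_def)
    then have "s \<in> S" using c(2) by (simp add: s_def)
    then obtain v where v: "v \<in> V" "(s - x * d 0) * v = 1"
      using maximal_avoiding_unit[OF inv V S avoid max _ d[of 0]] by blast
    show ?thesis
    proof (cases m)
      case 0
      then show ?thesis using b avoid[of "b 0"] by simp
    next
      case (Suc n)
      have uu: "u ^ m * u' ^ i = u ^ (m - i)" if "i \<le> m" for i
      proof -
        have "u ^ m = u ^ (m - i) * u ^ i" using that by (simp flip: power_add)
        then show ?thesis using u by (simp add: mult.assoc flip: power_mult_distrib)
      qed
      define T where "T = (\<Sum>i\<le>n. d (m - i) * u ^ i)"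
      have "u ^ m * s = x * (\<Sum>i\<le>m. d i * (u ^ m * u' ^ i))"
        by (simp add: s_def sum_distrib_left mult_ac)
      also have "(\<Sum>i\<le>m. d i * (u ^ m * u' ^ i)) = (\<Sum>i\<le>m. d i * u ^ (m - i))" by (simp add: uu)
      also have "\<dots> = (\<Sum>i\<le>m. d (m - i) * u ^ i)"
        using sum.nat_diff_reindex[of "\<lambda>i. d (m - i) * u ^ i" "Suc m"]
        by (simp add: lessThan_Suc_atMost)
      also have "\<dots> = T + d 0 * u ^ m" unfolding Suc by (simp add: T_def Suc)
      finally have "u ^ m * (s - x * d 0) = x * T" by (simp add: algebra_simps)
      then have um: "u ^ m = x * T * v" using v(2) by (metis mult.assoc mult.right_neutral)
      have "(\<Sum>i\<le>m. b i * u ^ i) = (\<Sum>i\<le>n. b i * u ^ i) + b m * u ^ m"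
        unfolding Suc by simp
      also have "b m * u ^ m = (\<Sum>i\<le>n. b m * x * v * d (m - i) * u ^ i)"
        unfolding um by (simp add: T_def sum_distrib_left sum_distrib_right mult_ac)
      also have "(\<Sum>i\<le>n. b i * u ^ i) + \<dots> = (\<Sum>i\<le>n. (b i + b m * x * v * d (m - i)) * u ^ i)"
        by (simp add: distrib_right sum.distrib)
      finally have "x * (\<Sum>i\<le>n. (b i + b m * x * v * d (m - i)) * u ^ i) \<in> S" using b(2) by simp
      moreover have "b i + b m * x * v * d (m - i) \<in> V" for i
        using b(1) V(2) v(1) d by (intro subring_add[OF V(1)] subring_mult[OF V(1)])
      ultimately have "good u n" unfolding good_def by (intro exI[of _ "\<lambda>i. b i + b m * x * v * d (m - i)"]) auto
      then show ?thesis using Suc by blast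
    qed
  qed
  define m where "m = (LEAST m. good z m)"
  define l where "l = (LEAST l. good z' l)"
  have m: "good z m" unfolding m_def using ex notin by (blast intro: LeastI_ex)
  have l: "good z' l" unfolding l_def using ex notin by (blast intro: LeastI_ex)
  show False
  proof (cases "l \<le> m")
    case True
    then show False using reduce[OF z m l] not_less_Least unfolding m_def by blast
  next
    case False
    have "z' * z = 1" using z by (simp add: mult.commute)
    then show False using reduce[OF _ l m] False not_less_Least unfolding l_def by (metis nat_le_linear)
  qed
qed

lemma transcendental_imp_maximal_subring:
  fixes x :: "'a::comm_ring_1"
  assumes inv: "\<And>x :: 'a. x \<noteq> 0 \<Longrightarrow> \<exists>w. x * w = 1"
    and k0: "is_subring k0" "transcendental_over k0 x"
  shows "has_maximal_subring TYPE('a)"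
proof -
  have dom: "b = 0" if ab: "a * b = 0" "a \<noteq> 0" for a b :: 'a
  proof -
    obtain w where "a * w = 1" using inv[OF ab(2)] by blast
    then have "b = w * (a * b)" by (metis mult.assoc mult.commute mult.left_neutral)
    then show ?thesis using ab(1) by simp
  qed
  obtain k where k: "is_subring k" "transcendental_over k x"
    and kmax: "\<And>k'. is_subring k' \<Longrightarrow> transcendental_over k' x \<Longrightarrow> k \<subseteq> k' \<Longrightarrow> k' = k"
    using maximal_transcendental_subring[OF k0] by blast
  define S where "S = k - {0}"
  have S: "1 \<in> S" "\<And>s t. s \<in> S \<Longrightarrow> t \<in> S \<Longrightarrow> s * t \<in> S"
    using subring_one[OF k(1)] subring_mult[OF k(1)] dom by (auto simp: S_def)
  let ?A = "{V. is_subring V \<and> adjoin k x \<subseteq> V \<and> (\<forall>b\<in>V. x * b \<notin> S)}"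
  have "\<exists>M\<in>?A. \<forall>V\<in>?A. M \<subseteq> V \<longrightarrow> V = M"
  proof (rule subset_Zorn_nonempty)
    have "x * b \<notin> S" if b: "b \<in> adjoin k x" for b
    proof
      assume s: "x * b \<in> S"
      obtain q where q: "q \<in> polys_over k" "b = poly q x" using b unfolding adjoin_def by blast
      have "pCons (- (x * b)) q \<in> polys_over k"
        using q(1) s subring_uminus[OF k(1)]
        by (auto simp: polys_over_def S_def coeff_pCons split: nat.split)
      moreover have "poly (pCons (- (x * b)) q) x = 0" by (simp add: q(2))
      ultimately have "pCons (- (x * b)) q = 0" using k(2) unfolding transcendental_over_def by blast
      then show False using s by (simp add: S_def)
    qed
    then have "adjoin k x \<in> ?A" using subring_adjoin[OF k(1)] by blast
    then show "?A \<noteq> {}" by blast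
    fix \<C> assume C: "\<C> \<noteq> {}" "subset.chain ?A \<C>"
    then have sub: "\<C> \<subseteq> ?A" by (simp add: subset_chain_def)
    have "is_subring (\<Union>\<C>)" using C sub by (intro subring_Union_chain) auto
    then show "\<Union>\<C> \<in> ?A" using C(1) sub by blast
  qed
  then obtain V where "V \<in> ?A" and Vmax: "\<forall>V'\<in>?A. V \<subseteq> V' \<longrightarrow> V' = V" by (rule bexE)
  then have V: "is_subring V" "adjoin k x \<subseteq> V" and avoid: "\<And>b. b \<in> V \<Longrightarrow> x * b \<notin> S" by auto
  have max: "V' = V" if "is_subring V'" "V \<subseteq> V'" "\<And>b. b \<in> V' \<Longrightarrow> x * b \<notin> S" for V'
    using Vmax that V(2) by auto
  have xV: "x \<in> V" using adjoin_generator[OF k(1)] V(2) by blast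
  have SV: "S \<subseteq> V" using adjoin_superset[OF k(1)] V(2) by (auto simp: S_def)
  have valuation: "z \<in> V \<or> z' \<in> V" if "z * z' = 1" for z z'
    using maximal_avoiding_valuation[OF inv V(1) xV SV S avoid max that] .
  have "x \<noteq> 0"
  proof
    assume "x = 0"
    have "[:0, 1:] \<in> polys_over k"
      using k(1) by (auto simp: polys_over_def coeff_pCons subring_zero subring_one split: nat.split)
    moreover have "poly [:0, 1:] x = 0" using \<open>x = 0\<close> by simp
    ultimately show False using k(2) unfolding transcendental_over_def by fastforce
  qed
  then obtain x' where x': "x * x' = 1" using inv by blast
  have xx': "x ^ r * x' ^ r = 1" for r using x' by (simp flip: power_mult_distrib)
  \<comment> \<open>Otherwise the inverse \<open>w\<close> of \<open>y\<close> is divisible in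
    \<open>V\<close> by every power of \<open>x\<close>. The constant term of an equation for
    \<open>w\<close> over \<open>adjoin k x\<close> has the form \<open>x ^ t * (s + x * b)\<close>,
    so divisibility of \<open>w\<close> beyond \<open>x ^ t\<close> makes \<open>s\<close> a
    multiple of \<open>x\<close> in \<open>V\<close>, which is avoided.\<close>
  have archimedean: "\<exists>r. x ^ r * y \<in> V" if "y \<noteq> 0" for y
  proof (rule ccontr)
    assume neg: "\<not> ?thesis"
    obtain w where w: "y * w = 1" using inv[OF \<open>y \<noteq> 0\<close>] by blast
    have wV: "x' ^ r * w \<in> V" for r
    proof -
      have "(x ^ r * y) * (x' ^ r * w) = (x ^ r * x' ^ r) * (y * w)" by (simp only: mult_ac)
      then show ?thesis using valuation[of "x ^ r * y" "x' ^ r * w"] neg w xx' by auto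
    qed
    have "u = 0" if "w * u = 0" for u using that w by (metis mult.assoc mult.left_neutral mult_zero_right)
    then obtain n a where a: "\<And>j. a j \<in> adjoin k x" "a 0 \<noteq> 0" "(\<Sum>j\<le>n. a j * w ^ j) = 0"
      using algebraic_over_adjoin[OF k kmax] by blast
    obtain q where q: "q \<in> polys_over k" "a 0 = poly q x" using a(1)[of 0] unfolding adjoin_def by blast
    have "q \<noteq> 0" using q(2) a(2) by auto
    then obtain t s b where tsb: "s \<in> k" "s \<noteq> 0" "b \<in> adjoin k x" "a 0 = x ^ t * (s + x * b)"
      using poly_over_factor_power[of q k x] q by metis
    define c where "c = (\<Sum>j<n. a (Suc j) * w ^ j)"
    have "c \<in> V" unfolding c_def
      using a(1) V(2) wV[of 0] by (intro subring_sum[OF V(1)] subring_mult[OF V(1)] subring_power[OF V(1)]) auto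
    have "a 0 + w * c = 0"
      using a(3) unfolding c_def sum.atMost_shift by (simp add: sum_distrib_left mult_ac)
    \<comment> \<open>One power more than in \<open>a 0\<close>, so that a factor \<open>x\<close>
      survives the cancellation of \<open>x ^ t\<close>.\<close>
    moreover have "w = x ^ Suc t * (x' ^ Suc t * w)" using xx'[of "Suc t"] by (metis mult.assoc mult.left_neutral)
    ultimately have "x ^ t * (s + x * b + x * (x' ^ Suc t * w) * c) = 0"
      unfolding tsb(4) by (simp add: algebra_simps)
    then have "s + x * b + x * (x' ^ Suc t * w) * c = 0"
      using xx'[of t] by (metis mult.assoc mult.commute mult.left_neutral mult_zero_right)
    then have "s + x * (b + (x' ^ Suc t * w) * c) = 0" by (simp only: distrib_left mult.assoc add.assoc)
    then have "s = - (x * (b + (x' ^ Suc t * w) * c))" by (simp only: eq_neg_iff_add_eq_0)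
    then have "x * - (b + (x' ^ Suc t * w) * c) = s" by (simp only: mult_minus_right)
    moreover have "- (b + (x' ^ Suc t * w) * c) \<in> V"
      using tsb(3) V(2) \<open>c \<in> V\<close>
      by (intro subring_add[OF V(1)] subring_uminus[OF V(1)] subring_mult[OF V(1) wV]) auto
    ultimately show False using avoid tsb(1,2) by (metis DiffI S_def empty_iff insert_iff)
  qed
  show ?thesis
  proof (rule finitely_generated_imp_maximal_subring[OF V(1), of "{x'}"])
    show "V \<noteq> UNIV" using avoid[of x'] S(1) x' by auto
    fix S' assume S': "is_subring S'" "V \<subseteq> S'" "{x'} \<subseteq> S'"
    have "y \<in> S'" for y
    proof (cases "y = 0")
      case False
      then obtain r where "x ^ r * y \<in> V" using archimedean by blast
      moreover have "x' ^ r \<in> S'" using S'(1,3) by (intro subring_power) auto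
      ultimately have "x' ^ r * (x ^ r * y) \<in> S'" using S'(1,2) by (blast intro: subring_mult)
      moreover have "x' ^ r * (x ^ r * y) = y"
        using xx'[of r] by (metis mult.assoc mult.commute mult.left_neutral)
      ultimately show ?thesis by simp
    qed (simp add: subring_zero[OF S'(1)])
    then show "S' = UNIV" by blast
  qed simp
qed

text \<open>Splitting off a linear factor at a root lowers the degree, and without zero divisors
  every other root is a root of the cofactor.\<close>

lemma finite_roots_no_zero_divisors:
  fixes p :: "'a::comm_ring_1 poly"
  assumes dom: "\<And>a b :: 'a. a * b = 0 \<Longrightarrow> a = 0 \<or> b = 0" and "p \<noteq> 0"
  shows "finite {x. poly p x = 0}"
  using assms(2)
proof (induction "degree p" arbitrary: p)
  case 0
  then obtain a where "p = [:a:]" "a \<noteq> 0" by (metis degree_eq_zeroE pCons_0_0)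
  then show ?case by simp
next
  case (Suc n)
  show ?case
  proof (cases "\<exists>c. poly p c = 0")
    case True
    then obtain c where c: "poly p c = 0" by blast
    define q where "q = synthetic_div p c"
    have p: "p = [:- c, 1:] * q" using synthetic_div_correct'[of c p] c by (simp add: q_def)
    have "degree q = n" using Suc.hyps(2) by (simp add: q_def degree_synthetic_div)
    moreover have "q \<noteq> 0" using p Suc.prems by auto
    ultimately have "finite {x. poly q x = 0}" using Suc.hyps(1) by blast
    moreover have "{x. poly p x = 0} \<subseteq> insert c {x. poly q x = 0}"
    proof
      fix x assume "x \<in> {x. poly p x = 0}"
      then have "(x - c) * poly q x = 0" by (subst (asm) p) (simp add: algebra_simps)
      then show "x \<in> insert c {x. poly q x = 0}" using dom by force
    qed
    ultimately show ?thesis by (meson finite.insertI finite_subset)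
  qed simp
qed

lemma countable_or_maximal_subring_field:
  assumes inv: "\<And>x :: 'a::comm_ring_1. x \<noteq> 0 \<Longrightarrow> \<exists>w. x * w = 1"
    and no_max: "\<not> has_maximal_subring TYPE('a)"
  shows "countable (UNIV :: 'a set)"
proof -
  have dom: "a = 0 \<or> b = 0" if "a * b = 0" for a b :: 'a
    using inv[of a] that by (metis mult.assoc mult.commute mult.left_neutral mult_zero_right)
  \<comment> \<open>The image of the integers serves both characteristics: it is the prime field in
    positive characteristic and a copy of the integers otherwise.\<close>
  let ?Z = "range of_int :: 'a set"
  have Z: "is_subring ?Z"
    unfolding is_subring_def
  proof (intro conjI ballI)
    show "1 \<in> ?Z" by (metis of_int_1 rangeI)
    fix x y assume "x \<in> ?Z" "y \<in> ?Z"
    then show "x - y \<in> ?Z" "x * y \<in> ?Z" by (auto simp flip: of_int_diff of_int_mult)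
  qed
  have "polys_over ?Z \<subseteq> range (\<lambda>l. Poly (map of_int l))"
  proof
    fix p assume "p \<in> polys_over ?Z"
    then have "coeffs p \<in> lists ?Z" by (auto simp: polys_over_def coeffs_def)
    then obtain l where "coeffs p = map of_int l" by (auto simp: lists_image)
    then have "p = Poly (map of_int l)" by (metis Poly_coeffs)
    then show "p \<in> range (\<lambda>l. Poly (map of_int l))" by blast
  qed
  then have "countable (polys_over ?Z)" by (rule countable_subset) simp
  then have "countable (\<Union>p\<in>polys_over ?Z - {0}. {x. poly p x = 0})"
    using finite_roots_no_zero_divisors[OF dom] by (intro countable_UN) (auto intro: countable_finite)
  moreover have "(\<Union>p\<in>polys_over ?Z - {0}. {x. poly p x = 0}) = UNIV"
  proof -
    have "\<not> transcendental_over ?Z x" for x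
      using transcendental_imp_maximal_subring[OF inv Z] no_max by blast
    then show ?thesis unfolding transcendental_over_def by blast
  qed
  ultimately show ?thesis by simp
qed

section \<open>Surjective ring homomorphisms\<close>

definition surj_ring_hom :: "('a::ring_1 \<Rightarrow> 'b::ring_1) \<Rightarrow> bool" where
  "surj_ring_hom h \<longleftrightarrow> surj h \<and> h 1 = 1 \<and> (\<forall>x y. h (x - y) = h x - h y \<and> h (x * y) = h x * h y)"

lemma surj_ring_hom_simps:
  assumes "surj_ring_hom h"
  shows surj_ring_hom_surj: "surj h" and surj_ring_hom_one: "h 1 = 1" and surj_ring_hom_zero: "h 0 = 0"
    and surj_ring_hom_diff: "h (x - y) = h x - h y" and surj_ring_hom_mult: "h (x * y) = h x * h y"
    and surj_ring_hom_add: "h (x + y) = h x + h y" and surj_ring_hom_power: "h (x ^ n) = h x ^ n"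
    and surj_ring_hom_sum: "h (sum g A) = (\<Sum>i\<in>A. h (g i))"
proof -
  show "surj h" and one: "h 1 = 1" and diff: "h (x - y) = h x - h y"
    and mult: "h (x * y) = h x * h y" for x y
    using assms by (auto simp: surj_ring_hom_def)
  show zero: "h 0 = 0" using diff[of 0 0] by simp
  have add: "h (x + y) = h x + h y" for x y using diff[of x "0 - y"] diff[of 0 y] zero by simp
  then show "h (x + y) = h x + h y" .
  show "h (x ^ n) = h x ^ n" by (induction n) (auto simp: one mult)
  show "h (sum g A) = (\<Sum>i\<in>A. h (g i))"
    by (induction A rule: infinite_finite_induct) (auto simp: zero add)
qed

text \<open>A subring above the preimage of \<open>M\<close> contains the kernel, so it is
  determined by its image, which is \<open>M\<close> or everything.\<close>

lemma surj_ring_hom_maximal_subring: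
  fixes h :: "'a::ring_1 \<Rightarrow> 'b::ring_1"
  assumes h: "surj_ring_hom h" and "has_maximal_subring TYPE('b)"
  shows "has_maximal_subring TYPE('a)"
proof -
  note hom = surj_ring_hom_simps[OF h]
  obtain M :: "'b set" where M: "is_subring M" "M \<noteq> UNIV"
    "\<And>S. is_subring S \<Longrightarrow> M \<subseteq> S \<Longrightarrow> S = M \<or> S = UNIV"
    using assms(2) unfolding has_maximal_subring_def maximal_subring_def by blast
  have "maximal_subring (h -` M)"
    unfolding maximal_subring_def
  proof (intro conjI allI impI)
    show "is_subring (h -` M)"
      using M(1) by (auto simp: is_subring_def hom)
    show "h -` M \<noteq> UNIV" using M(2) hom(1) by (metis UNIV_I surj_image_vimage_eq)
    fix S assume S: "is_subring S \<and> h -` M \<subseteq> S"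
    have "is_subring (h ` S)"
      unfolding is_subring_def
    proof (intro conjI ballI)
      show "1 \<in> h ` S" using S subring_one[of S] hom(2) by (metis imageI)
      fix a b assume "a \<in> h ` S" "b \<in> h ` S"
      then obtain x y where xy: "x \<in> S" "y \<in> S" "a = h x" "b = h y" by blast
      show "a - b \<in> h ` S" unfolding xy hom(4)[symmetric] using S xy by (blast intro: subring_diff)
      show "a * b \<in> h ` S" unfolding xy hom(5)[symmetric] using S xy by (blast intro: subring_mult)
    qed
    moreover have "M \<subseteq> h ` S" using S hom(1) by (metis image_mono surj_image_vimage_eq)
    ultimately consider "h ` S = M" | "h ` S = UNIV" using M(3) by blast
    then show "S = h -` M \<or> S = UNIV"
    proof cases
      case 2
      have "y \<in> S" for y
      proof -
        obtain s where s: "s \<in> S" "h y = h s" using 2 by (metis UNIV_I imageE)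
        then have "h (y - s) \<in> M" using subring_zero[OF M(1)] by (simp add: hom)
        then have "y - s \<in> S" using S by blast
        then show ?thesis using S s(1) subring_add[of S "y - s" s] by simp
      qed
      then show ?thesis by blast
    qed (use S in blast)
  qed
  then show ?thesis unfolding has_maximal_subring_def by blast
qed

lemma surj_ring_hom_left_ideal_vimage:
  assumes "surj_ring_hom h" "left_ideal I" shows "left_ideal (h -` I)"
  using assms(2) by (auto simp: left_ideal_def surj_ring_hom_simps[OF assms(1)])

lemma surj_ring_hom_two_sided_ideal_vimage:
  assumes "surj_ring_hom h" "two_sided_ideal I" shows "two_sided_ideal (h -` I)"
  using assms(2) surj_ring_hom_left_ideal_vimage[OF assms(1), of I]
  by (auto simp: two_sided_ideal_def surj_ring_hom_simps[OF assms(1)])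

lemma surj_ring_hom_left_noetherian:
  fixes h :: "'a::ring_1 \<Rightarrow> 'b::ring_1"
  assumes h: "surj_ring_hom h" and noeth: "left_noetherian TYPE('a)"
  shows "left_noetherian TYPE('b)"
  unfolding left_noetherian_def
proof (intro allI impI)
  fix I :: "nat \<Rightarrow> 'b set"
  assume I: "(\<forall>n. left_ideal (I n)) \<and> (\<forall>n. I n \<subseteq> I (Suc n))"
  then have "(\<forall>n. left_ideal (h -` I n)) \<and> (\<forall>n. h -` I n \<subseteq> h -` I (Suc n))"
    using surj_ring_hom_left_ideal_vimage[OF h] by blast
  then obtain N where "\<forall>m\<ge>N. h -` I m = h -` I N"
    using noeth[unfolded left_noetherian_def, rule_format, of "\<lambda>n. h -` I n"] by blast
  then show "\<exists>N. \<forall>m\<ge>N. I m = I N"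
    using surj_ring_hom_surj[OF h] by (metis surj_image_vimage_eq)
qed

lemma surj_ring_hom_integral_over_center:
  fixes h :: "'a::ring_1 \<Rightarrow> 'b::ring_1"
  assumes h: "surj_ring_hom h" and integral: "integral_over_center TYPE('a)"
  shows "integral_over_center TYPE('b)"
  unfolding integral_over_center_def
proof (intro allI)
  note hom = surj_ring_hom_simps[OF h]
  fix y :: 'b
  obtain x where x: "y = h x" using hom(1) by (metis surjD)
  obtain n and c :: "nat \<Rightarrow> 'a" where c: "\<And>i. i < n \<Longrightarrow> c i \<in> center"
    and rel: "x ^ n + (\<Sum>i<n. c i * x ^ i) = 0"
    using integral unfolding integral_over_center_def by blast
  have "h (c i) \<in> center" if "i < n" for i
    unfolding center_def
  proof (intro CollectI allI)
    fix b
    obtain a where "b = h a" using hom(1) by (metis surjD)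
    then show "h (c i) * b = b * h (c i)" using centerD[OF c[OF that], of a] by (simp flip: hom(5))
  qed
  moreover have "h (x ^ n + (\<Sum>i<n. c i * x ^ i)) = 0" by (simp add: rel hom(3))
  then have "y ^ n + (\<Sum>i<n. h (c i) * y ^ i) = 0" by (simp add: hom x)
  ultimately show "\<exists>n c. (\<forall>i<n. c i \<in> center) \<and> y ^ n + (\<Sum>i<n. c i * y ^ i) = 0"
    by (intro exI[of _ n] exI[of _ "\<lambda>i. h (c i)"]) auto
qed

lemma surj_ring_hom_small_quotient_vimage:
  fixes h :: "'a::ring_1 \<Rightarrow> 'b::ring_1"
  assumes h: "surj_ring_hom h"
  shows "small_quotient (h -` I) \<longleftrightarrow> small_quotient I"
proof
  note hom = surj_ring_hom_simps[OF h]
  assume "small_quotient I"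
  then obtain f :: "'b \<Rightarrow> nat set" where "\<And>x y. f x = f y \<Longrightarrow> x - y \<in> I"
    unfolding small_quotient_def by blast
  then show "small_quotient (h -` I)"
    unfolding small_quotient_def by (intro exI[of _ "\<lambda>x. f (h x)"]) (simp add: hom)
next
  note hom = surj_ring_hom_simps[OF h]
  assume "small_quotient (h -` I)"
  then obtain f :: "'a \<Rightarrow> nat set" where f: "\<And>x y. f x = f y \<Longrightarrow> x - y \<in> h -` I"
    unfolding small_quotient_def by blast
  have "x - y \<in> I" if "f (inv h x) = f (inv h y)" for x y
    using f[OF that] hom(1) by (simp add: hom surj_f_inv_f)
  then show "small_quotient I"
    unfolding small_quotient_def by (intro exI[of _ "\<lambda>x. f (inv h x)"]) simp
qed

section \<open>The center as a commutative ring\<close>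

text \<open>The results on fields live in class \<open>comm_ring_1\<close>, whereas commutativity of
  the division ring is only a derived fact. The center is an instance over every base ring and
  coincides with the ring when that is commutative.\<close>

typedef (overloaded) 'a center_ring = "center :: 'a::ring_1 set"
  using subring_one[OF subring_center] by blast

setup_lifting type_definition_center_ring

instantiation center_ring :: (ring_1) comm_ring_1
begin

lift_definition zero_center_ring :: "'a center_ring" is 0
  by (rule subring_zero[OF subring_center])
lift_definition one_center_ring :: "'a center_ring" is 1
  by (rule subring_one[OF subring_center])
lift_definition plus_center_ring :: "'a center_ring \<Rightarrow> 'a center_ring \<Rightarrow> 'a center_ring" is "(+)"
  by (rule subring_add[OF subring_center])
lift_definition minus_center_ring :: "'a center_ring \<Rightarrow> 'a center_ring \<Rightarrow> 'a center_ring" is "(-)"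
  by (rule subring_diff[OF subring_center])
lift_definition uminus_center_ring :: "'a center_ring \<Rightarrow> 'a center_ring" is "uminus"
  by (rule subring_uminus[OF subring_center])
lift_definition times_center_ring :: "'a center_ring \<Rightarrow> 'a center_ring \<Rightarrow> 'a center_ring" is "(*)"
  by (rule subring_mult[OF subring_center])

instance
  by standard (transfer; simp add: algebra_simps centerD)+

end

lemma surj_ring_hom_Abs_center_ring:
  assumes "\<And>x y :: 'a::ring_1. x * y = y * x"
  shows "surj_ring_hom (Abs_center_ring :: 'a \<Rightarrow> 'a center_ring)"
proof -
  have mem: "x \<in> center" for x :: 'a using assms by (simp add: center_def)
  have "surj (Abs_center_ring :: 'a \<Rightarrow> 'a center_ring)" by (metis Rep_center_ring_inverse surjI)
  then show ?thesis
    by (simp add: surj_ring_hom_def one_center_ring_def minus_center_ring.abs_eq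
        times_center_ring.abs_eq eq_onp_def mem)
qed

lemma countable_or_maximal_subring_commutative_division:
  assumes comm: "\<And>x y :: 'a::ring_1. x * y = y * x"
    and inv: "\<And>x :: 'a. x \<noteq> 0 \<Longrightarrow> \<exists>w. x * w = 1"
    and no_max: "\<not> has_maximal_subring TYPE('a)"
  shows "countable (UNIV :: 'a set)"
proof -
  let ?h = "Abs_center_ring :: 'a \<Rightarrow> 'a center_ring"
  have h: "surj_ring_hom ?h" using comm by (rule surj_ring_hom_Abs_center_ring)
  have "\<exists>w. x * w = 1" if "x \<noteq> 0" for x :: "'a center_ring"
  proof -
    obtain y where y: "x = ?h y" using surj_ring_hom_surj[OF h] by (metis surjD)
    then have "y \<noteq> 0" using that surj_ring_hom_zero[OF h] by auto
    then obtain w where "y * w = 1" using inv by blast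
    then have "x * ?h w = 1" using surj_ring_hom_mult[OF h, of y w] surj_ring_hom_one[OF h] y by simp
    then show ?thesis by blast
  qed
  moreover have "\<not> has_maximal_subring TYPE('a center_ring)"
    using surj_ring_hom_maximal_subring[OF h] no_max by blast
  ultimately have "countable (UNIV :: 'a center_ring set)" by (rule countable_or_maximal_subring_field)
  moreover have "inj ?h"
    using comm by (intro injI) (simp add: Abs_center_ring_inject center_def)
  ultimately show ?thesis by (metis countable_image_inj_on countable_subset subset_UNIV)
qed

section \<open>The quotient by a maximal large ideal\<close>

text \<open>A counterexample has a quotient that is minimal among its large quotients. To have this quotient
  available as a type of class \<^class>\<open>ring_1\<close>, the ideal is chosen by a constant, which is an arbitrary
  proper ideal when every quotient is small.\<close>

definition maximal_large_ideal :: "'a::ring_1 set \<Rightarrow> bool" where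
  "maximal_large_ideal I \<longleftrightarrow> two_sided_ideal I \<and> \<not> small_quotient I \<and>
     (\<forall>J. two_sided_ideal J \<longrightarrow> I \<subset> J \<longrightarrow> small_quotient J)"

definition chosen_ideal :: "'a::ring_1 set" where
  "chosen_ideal = (SOME I. two_sided_ideal I \<and> 1 \<notin> I \<and>
     ((\<exists>J :: 'a set. maximal_large_ideal J) \<longrightarrow> maximal_large_ideal I))"

lemma two_sided_ideal_zero: "two_sided_ideal {0 :: 'a::ring_1}"
  by (simp add: two_sided_ideal_def left_ideal_def)

lemma large_ideal_proper:
  assumes "two_sided_ideal I" "\<not> small_quotient I" shows "1 \<notin> I"
proof
  assume "1 \<in> I"
  then have "r * 1 \<in> I" for r using assms(1) unfolding two_sided_ideal_def left_ideal_def by blast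
  then have "small_quotient I" by (simp add: small_quotient_def)
  then show False using assms(2) by blast
qed

lemma chosen_ideal:
  shows chosen_ideal_two_sided: "two_sided_ideal (chosen_ideal :: 'a::ring_1 set)"
    and chosen_ideal_proper: "1 \<notin> (chosen_ideal :: 'a set)"
    and chosen_ideal_maximal_large:
      "maximal_large_ideal (J :: 'a set) \<Longrightarrow> maximal_large_ideal (chosen_ideal :: 'a set)"
proof -
  have "\<exists>I :: 'a set. two_sided_ideal I \<and> 1 \<notin> I \<and>
     ((\<exists>J :: 'a set. maximal_large_ideal J) \<longrightarrow> maximal_large_ideal I)"
  proof (cases "\<exists>J :: 'a set. maximal_large_ideal J")
    case True
    then obtain J :: "'a set" where J: "maximal_large_ideal J" by blast
    then have "two_sided_ideal J" "1 \<notin> J"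
      using large_ideal_proper unfolding maximal_large_ideal_def by blast+
    then show ?thesis using J by blast
  next
    case False
    then show ?thesis using two_sided_ideal_zero by (intro exI[of _ "{0}"]) auto
  qed
  then have "two_sided_ideal (chosen_ideal :: 'a set) \<and> 1 \<notin> (chosen_ideal :: 'a set) \<and>
     ((\<exists>J :: 'a set. maximal_large_ideal J) \<longrightarrow> maximal_large_ideal (chosen_ideal :: 'a set))"
    unfolding chosen_ideal_def by (rule someI_ex)
  then show "two_sided_ideal (chosen_ideal :: 'a set)" "1 \<notin> (chosen_ideal :: 'a set)"
    "maximal_large_ideal (J :: 'a set) \<Longrightarrow> maximal_large_ideal (chosen_ideal :: 'a set)" by blast+
qed

lemma chosen_ideal_closed:
  fixes x y :: "'a::ring_1"
  shows chosen_ideal_zero: "0 \<in> (chosen_ideal :: 'a set)"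
    and chosen_ideal_diff: "x \<in> chosen_ideal \<Longrightarrow> y \<in> chosen_ideal \<Longrightarrow> x - y \<in> chosen_ideal"
    and chosen_ideal_add: "x \<in> chosen_ideal \<Longrightarrow> y \<in> chosen_ideal \<Longrightarrow> x + y \<in> chosen_ideal"
    and chosen_ideal_mult_left: "x \<in> chosen_ideal \<Longrightarrow> y * x \<in> chosen_ideal"
    and chosen_ideal_mult_right: "x \<in> chosen_ideal \<Longrightarrow> x * y \<in> chosen_ideal"
proof -
  show zero: "0 \<in> (chosen_ideal :: 'a set)"
    and diff: "x \<in> chosen_ideal \<Longrightarrow> y \<in> chosen_ideal \<Longrightarrow> x - y \<in> chosen_ideal"
    and "x \<in> chosen_ideal \<Longrightarrow> y * x \<in> chosen_ideal"
    and "x \<in> chosen_ideal \<Longrightarrow> x * y \<in> chosen_ideal" for x y :: 'a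
    using chosen_ideal_two_sided unfolding two_sided_ideal_def left_ideal_def by blast+
  show "x \<in> chosen_ideal \<Longrightarrow> y \<in> chosen_ideal \<Longrightarrow> x + y \<in> chosen_ideal"
    using diff[of x "0 - y"] diff[OF zero, of y] by simp
qed

quotient_type (overloaded) 'a chosen_quotient = "'a::ring_1" / "\<lambda>x y. x - y \<in> chosen_ideal"
proof (intro equivpI reflpI sympI transpI)
  fix x y z :: 'a
  show "x - x \<in> chosen_ideal" by (simp add: chosen_ideal_zero)
  show "y - x \<in> chosen_ideal" if "x - y \<in> chosen_ideal"
    using chosen_ideal_diff[OF chosen_ideal_zero that] by simp
  show "x - z \<in> chosen_ideal" if "x - y \<in> chosen_ideal" "y - z \<in> chosen_ideal"
    using chosen_ideal_add[OF that] by simp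
qed

instantiation chosen_quotient :: (ring_1) ring_1
begin

lift_definition zero_chosen_quotient :: "'a chosen_quotient" is 0 .
lift_definition one_chosen_quotient :: "'a chosen_quotient" is 1 .
lift_definition plus_chosen_quotient :: "'a chosen_quotient \<Rightarrow> 'a chosen_quotient \<Rightarrow> 'a chosen_quotient" is "(+)"
  by (drule (1) chosen_ideal_add) (simp add: algebra_simps)
lift_definition minus_chosen_quotient :: "'a chosen_quotient \<Rightarrow> 'a chosen_quotient \<Rightarrow> 'a chosen_quotient" is "(-)"
  by (drule (1) chosen_ideal_diff) (simp add: algebra_simps)
lift_definition uminus_chosen_quotient :: "'a chosen_quotient \<Rightarrow> 'a chosen_quotient" is "uminus"
  by (drule chosen_ideal_diff[OF chosen_ideal_zero]) (simp add: algebra_simps)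
lift_definition times_chosen_quotient :: "'a chosen_quotient \<Rightarrow> 'a chosen_quotient \<Rightarrow> 'a chosen_quotient" is "(*)"
proof -
  fix x x' y y' :: 'a
  assume "x - x' \<in> chosen_ideal" "y - y' \<in> chosen_ideal"
  then have "(x - x') * y + x' * (y - y') \<in> chosen_ideal"
    by (intro chosen_ideal_add chosen_ideal_mult_left chosen_ideal_mult_right)
  then show "x * y - x' * y' \<in> chosen_ideal" by (simp add: algebra_simps)
qed

instance
proof
  have "0 - 1 \<notin> (chosen_ideal :: 'a set)"
    using chosen_ideal_proper chosen_ideal_diff[OF chosen_ideal_zero, of "0 - 1"] by auto
  then show "(0 :: 'a chosen_quotient) \<noteq> 1"
    by (simp add: zero_chosen_quotient_def one_chosen_quotient_def chosen_quotient.abs_eq_iff)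
qed (transfer; simp add: algebra_simps chosen_ideal_zero)+

end

lemma surj_ring_hom_abs_chosen_quotient:
  "surj_ring_hom (abs_chosen_quotient :: 'a::ring_1 \<Rightarrow> 'a chosen_quotient)"
proof -
  have "surj (abs_chosen_quotient :: 'a \<Rightarrow> 'a chosen_quotient)"
    using Quotient_abs_rep[OF Quotient_chosen_quotient] by (metis surjI)
  then show ?thesis
    by (simp add: surj_ring_hom_def one_chosen_quotient_def minus_chosen_quotient.abs_eq
        times_chosen_quotient.abs_eq)
qed

lemma abs_chosen_quotient_eq_zero_iff:
  "abs_chosen_quotient x = 0 \<longleftrightarrow> x \<in> (chosen_ideal :: 'a::ring_1 set)"
  by (simp add: zero_chosen_quotient_def chosen_quotient.abs_eq_iff)

theorem theorem4p8:
  assumes "left_noetherian TYPE('a::ring_1)"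
    and "integral_over_center TYPE('a)"
  shows "has_maximal_subring TYPE('a) \<or> (\<exists>f :: 'a \<Rightarrow> nat set. inj f)"
proof (rule ccontr)
  assume neg: "\<not> ?thesis"
  let ?R = "TYPE('a chosen_quotient)"
  let ?h = "abs_chosen_quotient :: 'a \<Rightarrow> 'a chosen_quotient"
  have h: "surj_ring_hom ?h" by (rule surj_ring_hom_abs_chosen_quotient)
  have noeth: "left_noetherian ?R" using h assms(1) by (rule surj_ring_hom_left_noetherian)
  have integral: "integral_over_center ?R" using h assms(2) by (rule surj_ring_hom_integral_over_center)
  have no_max: "\<not> has_maximal_subring ?R" using surj_ring_hom_maximal_subring[OF h] neg by blast
  let ?S = "{I :: 'a set. two_sided_ideal I \<and> \<not> small_quotient I}"
  have "{0} \<in> ?S" using neg two_sided_ideal_zero small_quotient_zero_iff by blast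
  then have nonempty: "?S \<noteq> {}" by blast
  obtain J where "J \<in> ?S" "\<And>I. I \<in> ?S \<Longrightarrow> J \<subseteq> I \<Longrightarrow> I = J"
    by (rule left_noetherian_maximal[OF assms(1) nonempty]) (auto simp: two_sided_ideal_def)
  then have "maximal_large_ideal J" unfolding maximal_large_ideal_def by blast
  then have chosen: "maximal_large_ideal (chosen_ideal :: 'a set)" by (rule chosen_ideal_maximal_large)
  have vimage: "?h -` {0} = chosen_ideal" using abs_chosen_quotient_eq_zero_iff by blast
  then have large: "\<not> small_quotient {0 :: 'a chosen_quotient}"
    using chosen surj_ring_hom_small_quotient_vimage[OF h, of "{0}"]
    unfolding maximal_large_ideal_def by simp
  \<comment> \<open>The preimage of a nonzero ideal lies strictly above the chosen ideal, so
    maximality makes it small.\<close>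
  have proper: "small_quotient I" if I: "two_sided_ideal I" "I \<noteq> {0}" for I :: "'a chosen_quotient set"
  proof -
    have "0 \<in> I" using I(1) unfolding two_sided_ideal_def left_ideal_def by blast
    then have "{0} \<subset> I" using I(2) by blast
    then have "chosen_ideal \<subset> ?h -` I"
      unfolding vimage[symmetric] using surj_ring_hom_surj[OF h]
      by (metis psubset_eq surj_image_vimage_eq vimage_mono)
    then show ?thesis
      using chosen surj_ring_hom_two_sided_ideal_vimage[OF h I(1)]
        surj_ring_hom_small_quotient_vimage[OF h, of I]
      unfolding maximal_large_ideal_def by blast
  qed
  note prime = minimal_large_prime[OF noeth large proper]
  note units = minimal_large_center_field[OF noeth integral large proper]
  have inv: "\<exists>w. z * w = 1 \<and> w * z = 1" if "z \<noteq> 0" for z :: "'a chosen_quotient"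
    using division_or_maximal_subring[OF noeth integral prime units no_max that] .
  have comm: "x * y = y * x" for x y :: "'a chosen_quotient"
    using noncommutative_division_imp_maximal_subring[OF integral inv] no_max by blast
  have "countable (UNIV :: 'a chosen_quotient set)"
    using countable_or_maximal_subring_commutative_division[OF comm _ no_max] inv by blast
  \<comment> \<open>Singletons turn the enumeration into an injection into sets of naturals, so the
    quotient would be small.\<close>
  then have "inj (\<lambda>x :: 'a chosen_quotient. {to_nat_on UNIV x})"
    by (auto intro!: injI dest: inj_onD[OF inj_on_to_nat_on])
  then show False using large small_quotient_zero_iff by blast
qed
end
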